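(* Let $V$ be the $\mathcal O_q$-module, with all associated notation, described in the context, and put $$N=\frac{a^{-1}K^{-1}-aB^{-1}}{a^{-1}-a},\qquad N^\downarrow=\frac{a^{-1}(K^\downarrow)^{-1}-a(B^\downarrow)^{-1}}{a^{-1}-a}.$$ Consider the directed graph with six vertices $[0],[d],[0^*],[d^*],[0^+],[d^+]$ (the flags defined in the context) and the following ten arcs, each labelled by an invertible element of $\mathrm{End}(V)$: $[0]\to[0^*]$ labelled $B^{-1}$; $[d]\to[0^*]$ labelled $K^{-1}$; $[0]\to[d^*]$ labelled $(B^\downarrow)^{-1}$; $[d]\to[d^*]$ labelled $(K^\downarrow)^{-1}$; $[0^+]\to[0]$ labelled $aA-a^2B^{-1}$; $[0^+]\to[d]$ labelled $a^{-1}A-a^{-2}K^{-1}$; $[d^+]\to[0]$ labelled $aA-a^2(B^\downarrow)^{-1}$; $[d^+]\to[d]$ labelled $a^{-1}A-a^{-2}(K^\downarrow)^{-1}$; $[0^*]\to[0^+]$ labelled $N^{-1}$; $[d^*]\to[d^+]$ labelled $(N^\downarrow)^{-1}$. Then for each oriented 3-cycle in this graph, the labels of its three consecutive arcs (in the cyclic order of the cycle) form an equitable triple on $V$. Explicitly, the oriented 3-cycles give the equitable triples $(B^{-1},\,N^{-1},\,aA-a^2B^{-1})$, $(K^{-1},\,N^{-1},\,a^{-1}A-a^{-2}K^{-1})$, $((B^\downarrow)^{-1},\,(N^\downarrow)^{-1},\,aA-a^2(B^\downarrow)^{-1})$, $((K^\downarrow)^{-1},\,(N^\downarrow)^{-1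},\,a^{-1}A-a^{-2}(K^\downarrow)^{-1})$.
   Context: Setting. $\mathbb F$ is a field and $q\in\mathbb F$ is nonzero and not a root of unity. Algebras are associative, unital, over $\mathbb F$. Write $[X,Y]=XY-YX$, $[X,Y]_q=qXY-q^{-1}YX$, $[X,Y]_{q^{-1}}=q^{-1}XY-qYX$. The $q$-Onsager algebra $\mathcal O_q$ is defined by generators $A,A^*$ and relations $[A,[A,[A,A^*]_q]_{q^{-1}}]=(q^2-q^{-2})^2[A^*,A]$ and $[A^*,[A^*,[A^*,A]_q]_{q^{-1}}]=(q^2-q^{-2})^2[A,A^*]$. $V$ is an irreducible $\mathcal O_q$-module of finite dimension at least $2$ on which each of $A,A^*$ is diagonalizable; elements of $\mathcal O_q$ are identified with their actions on $V$. Eigenspaces. The eigenvalues of $A$ on $V$ can be ordered as mutually distinct $\theta_0,\dots,\theta_d$ ($d\ge 1$) such that $\theta_i=aq^{d-2i}+a^{-1}q^{2i-d}$ ($0\le i\le d$) for some nonzero $a\in\mathbb F$; fix such an ordering and $a$. $V_i$ is the $\theta_i$-eigenspace of $A$ and $E_i\in\mathrm{End}(V)$ is the projection onto $V_i$ along $\bigoplus_{j\ne i}V_j$; one has $A^*V_i\subseteq V_{i-1}+V_i+V_{i+1}$ ($V_{-1}=V_{d+1}=0$). $A^*$ also has exactly $d+1$ eigenspaces on $V$, and they can be ordered $V^*_0,\dots,V^*_d$ so that $AV^*_i\subseteq V^*_{i-1}+V^*_i+V^*_{i+1}$ ($V^*_{-1}=V^*_{d+1}=0$); fix such an ordering and let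 $\theta_i^*$ be the eigenvalue of $A^*$ on $V^*_i$. One has $a^2\ne 1$. Lusztig automorphism. $L$ is the automorphism of $\mathcal O_q$ with $L(A)=A$, $L(A^* )=A^*+\frac{[A,[A,A^*]_q]}{(q-q^{-1})(q^2-q^{-2})}$. The map $H$. Let $t_{ij}=1+\frac{\theta_i-\theta_j}{q-q^{-1}}\cdot\frac{q\theta_i-q^{-1}\theta_j}{q^2-q^{-2}}$, $t_i=t_{01}t_{12}\cdots t_{i-1,i}$ ($t_0=1$), and $H=\sum_{i=0}^d t_iE_i\in\mathrm{End}(V)$; each $t_i\neq0$, so $H$ is invertible. Put $V^+_i=H^{-1}V^*_i$ ($0\le i\le d$); $V^+_i$ is the eigenspace of $L(A^* )$ on $V$ with eigenvalue $\theta^*_i$. Maps. A decomposition of $V$ is a sequence $\{W_i\}_{i=0}^d$ of nonzero subspaces with direct sum $V$; its corresponding map is the $M\in\mathrm{End}(V)$ acting on $W_i$ as $q^{d-2i}$ times the identity ($0\le i\le d$). $K,B,K^\downarrow,B^\downarrow$ are the maps corresponding to the decompositions $\{W_i\}_{i=0}^d$ (each known to be a decomposition) given respectively by: $K$: $W_i=(V^*_0+\cdots+V^*_i)\cap(V_i+\cdots+V_d)$; $B$: $W_i=(V^*_0+\cdots+V^*_i)\cap(V_0+\cdots+V_{d-i})$; $K^\downarrow$: $W_i=(V^*_{d-i}+\cdots+V^*_d)\cap(V_i+\cdots+V_d)$; $B^\downarrow$: $W_i=(V^*_{d-i}+\cdots+V^*_d)\cap(V_0+\cdots+V_{d-i})$.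 The maps $N$, $N^\downarrow$ of the claim are known to be invertible. Flags (used only as vertex names of the graph). For $0\le i\le d$ put $[0]_i=V_0+\cdots+V_i$, $[d]_i=V_{d-i}+\cdots+V_d$, $[0^*]_i=V^*_0+\cdots+V^*_i$, $[d^*]_i=V^*_{d-i}+\cdots+V^*_d$, $[0^+]_i=V^+_0+\cdots+V^+_i$, $[d^+]_i=V^+_{d-i}+\cdots+V^+_d$. Each arc $F\to G$ of the graph records that its label is diagonalizable with eigenvalues $\{q^{d-2i}\}_{i=0}^d$ and, with $M_i$ its $q^{d-2i}$-eigenspace, $M_0+\cdots+M_i=F_i$ and $M_{d-i}+\cdots+M_d=G_i$ ($0\le i\le d$). Equitable triple. An equitable triple on $V$ is a 3-tuple $X,Y,Z$ of invertible elements of $\mathrm{End}(V)$ such that $\frac{qXY-q^{-1}YX}{q-q^{-1}}=I$, $\frac{qYZ-q^{-1}ZY}{q-q^{-1}}=I$, $\frac{qZX-q^{-1}XZ}{q-q^{-1}}=I$ (this condition is invariant under cyclic rotation of $X,Y,Z$). *)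

theory Defs
  imports Complex_Main "HOL-Algebra.QuotRing" "HOL-Library.Poly_Mapping"
begin

section \<open>The q-Onsager algebra\<close>

text \<open>The free algebra on two generators over a field is the monoid algebra of the free monoid
  of words. Finitely supported functions on a monoid multiply by convolution, so it
  suffices to make the words an (additively written) monoid under concatenation.\<close>

datatype oq_gen = Gen_A | Gen_As

datatype oq_word = Word "oq_gen list"

instantiation oq_word :: monoid_add
begin

definition zero_oq_word :: oq_word where
  "0 = Word []"

fun plus_oq_word :: "oq_word \<Rightarrow> oq_word \<Rightarrow> oq_word" where
  "Word xs + Word ys = Word (xs @ ys)"

instance
proof
  fix x y z :: oq_word
  show "x + y + z = x + (y + z)"
    by (cases x; cases y; cases z) simp
  show "0 + x = x"
    by (cases x) (simp add: zero_oq_word_def)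
  show "x + 0 = x"
    by (cases x) (simp add: zero_oq_word_def)
qed

end

type_synonym 'f free_alg = "oq_word \<Rightarrow>\<^sub>0 'f"

definition fgen :: "oq_gen \<Rightarrow> 'f::field free_alg" where
  "fgen g = Poly_Mapping.single (Word [g]) 1"

definition fconst :: "'f::field \<Rightarrow> 'f free_alg" where
  "fconst c = Poly_Mapping.single 0 c"

definition comm :: "'f::field free_alg \<Rightarrow> 'f free_alg \<Rightarrow> 'f free_alg" where
  "comm X Y = X * Y - Y * X"

definition qcomm :: "'f::field \<Rightarrow> 'f free_alg \<Rightarrow> 'f free_alg \<Rightarrow> 'f free_alg" where
  "qcomm q X Y = fconst q * X * Y - fconst (inverse q) * Y * X"

definition oq_relator :: "'f::field \<Rightarrow> 'f free_alg \<Rightarrow> 'f free_alg \<Rightarrow> 'f free_alg" where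
  "oq_relator q X Y =
     comm X (qcomm (inverse q) X (qcomm q X Y)) - fconst ((q^2 - (inverse q)^2)^2) * comm Y X"

definition free_ring :: "'f::field free_alg ring" where
  "free_ring = \<lparr>carrier = UNIV, mult = (*), one = 1, zero = 0, add = (+)\<rparr>"

definition oq_ideal :: "'f::field \<Rightarrow> 'f free_alg set" where
  "oq_ideal q = genideal free_ring
     {oq_relator q (fgen Gen_A) (fgen Gen_As), oq_relator q (fgen Gen_As) (fgen Gen_A)}"

definition q_Onsager :: "'f::field \<Rightarrow> 'f free_alg set ring" where
  "q_Onsager q = free_ring Quot oq_ideal q"

definition oq_class :: "'f::field \<Rightarrow> 'f free_alg \<Rightarrow> 'f free_alg set" where
  "oq_class q x = oq_ideal q +>\<^bsub>free_ring\<^esub> x"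

definition oq_A :: "'f::field \<Rightarrow> 'f free_alg set" where
  "oq_A q = oq_class q (fgen Gen_A)"

definition oq_As :: "'f::field \<Rightarrow> 'f free_alg set" where
  "oq_As q = oq_class q (fgen Gen_As)"

text \<open>The vector space is the whole type \<open>'v\<close> with scalar multiplication \<open>scale\<close>. The scalar
  \<open>c\<close> times the unit of the algebra is \<open>oq_class q (fconst c)\<close>, so the last
  clause gives both unitality and compatibility of the action with the scalars of the algebra.\<close>

definition oq_module ::
  "'f::field \<Rightarrow> ('f \<Rightarrow> 'v::ab_group_add \<Rightarrow> 'v) \<Rightarrow> ('f free_alg set \<Rightarrow> 'v \<Rightarrow> 'v) \<Rightarrow> bool" where
  "oq_module q scale act \<longleftrightarrow>
     vector_space scale \<and>
     (\<forall>x\<in>carrier (q_Onsager q). Vector_Spaces.linear scale scale (act x)) \<and>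
     (\<forall>x\<in>carrier (q_Onsager q). \<forall>y\<in>carrier (q_Onsager q). \<forall>v.
        act (x \<oplus>\<^bsub>q_Onsager q\<^esub> y) v = act x v + act y v) \<and>
     (\<forall>x\<in>carrier (q_Onsager q). \<forall>y\<in>carrier (q_Onsager q). \<forall>v.
        act (x \<otimes>\<^bsub>q_Onsager q\<^esub> y) v = act x (act y v)) \<and>
     (\<forall>c v. act (oq_class q (fconst c)) v = scale c v)"

definition irreducible_oq_module ::
  "'f::field \<Rightarrow> ('f \<Rightarrow> 'v::ab_group_add \<Rightarrow> 'v) \<Rightarrow> ('f free_alg set \<Rightarrow> 'v \<Rightarrow> 'v) \<Rightarrow> bool" where
  "irreducible_oq_module q scale act \<longleftrightarrow>
     oq_module q scale act \<and>
     (UNIV :: 'v set) \<noteq> {0} \<and>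
     (\<forall>W. module.subspace scale W \<and> (\<forall>x\<in>carrier (q_Onsager q). act x ` W \<subseteq> W)
        \<longrightarrow> W = {0} \<or> W = UNIV)"


section \<open>Eigenspaces and decompositions\<close>

definition eigenspace :: "('f \<Rightarrow> 'v \<Rightarrow> 'v) \<Rightarrow> ('v \<Rightarrow> 'v) \<Rightarrow> 'f \<Rightarrow> 'v set" where
  "eigenspace scale T c = {v. T v = scale c v}"

definition is_eigenvalue :: "('f \<Rightarrow> 'v::zero \<Rightarrow> 'v) \<Rightarrow> ('v \<Rightarrow> 'v) \<Rightarrow> 'f \<Rightarrow> bool" where
  "is_eigenvalue scale T c \<longleftrightarrow> (\<exists>v. v \<noteq> 0 \<and> T v = scale c v)"

definition diagonalizable :: "('f::field \<Rightarrow> 'v::ab_group_add \<Rightarrow> 'v) \<Rightarrow> ('v \<Rightarrow> 'v) \<Rightarrow> bool" where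
  "diagonalizable scale T \<longleftrightarrow>
     (\<exists>S. \<not> module.dependent scale S \<and> module.span scale S = UNIV \<and>
          (\<forall>v\<in>S. \<exists>c. T v = scale c v))"

definition eigenvalue_ordering ::
  "('f \<Rightarrow> 'v::zero \<Rightarrow> 'v) \<Rightarrow> ('v \<Rightarrow> 'v) \<Rightarrow> nat \<Rightarrow> (nat \<Rightarrow> 'f) \<Rightarrow> bool" where
  "eigenvalue_ordering scale T d \<theta> \<longleftrightarrow>
     inj_on \<theta> {0..d} \<and> {c. is_eigenvalue scale T c} = \<theta> ` {0..d}"

definition subspace_sum ::
  "('f::field \<Rightarrow> 'v::ab_group_add \<Rightarrow> 'v) \<Rightarrow> nat set \<Rightarrow> (nat \<Rightarrow> 'v set) \<Rightarrow> 'v set" where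
  "subspace_sum scale J W = module.span scale (\<Union>j\<in>J. W j)"

text \<open>The conventions \<open>W (-1) = W (d + 1) = 0\<close> are rendered by restricting the
  neighbours of \<open>i\<close> to \<open>{0..d}\<close>.\<close>

definition acts_tridiagonally ::
  "('f::field \<Rightarrow> 'v::ab_group_add \<Rightarrow> 'v) \<Rightarrow> nat \<Rightarrow> ('v \<Rightarrow> 'v) \<Rightarrow> (nat \<Rightarrow> 'v set) \<Rightarrow> bool" where
  "acts_tridiagonally scale d T W \<longleftrightarrow>
     (\<forall>i\<le>d. T ` W i \<subseteq> subspace_sum scale {j. j \<le> d \<and> i \<le> j + 1 \<and> j \<le> i + 1} W)"

text \<open>For a decomposition \<open>W 0, \<dots>, W d\<close> of the space, this is the unique linear map
  acting on \<open>W i\<close> as \<open>q\<close> to the power \<open>d - 2 i\<close>.\<close>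

definition corresponding_map ::
  "('f::field \<Rightarrow> 'v::ab_group_add \<Rightarrow> 'v) \<Rightarrow> 'f \<Rightarrow> nat \<Rightarrow> (nat \<Rightarrow> 'v set) \<Rightarrow> 'v \<Rightarrow> 'v" where
  "corresponding_map scale q d W =
     (THE M. Vector_Spaces.linear scale scale M \<and>
        (\<forall>i\<le>d. \<forall>w\<in>W i. M w = scale (q powi (int d - 2 * int i)) w))"


section \<open>Equitable triples and the labelled graph\<close>

text \<open>Alternative to the HOL syntax for function inverse, which is shadowed by
  the syntax for inverses in groups.\<close>

abbreviation map_inv :: "('v \<Rightarrow> 'v) \<Rightarrow> 'v \<Rightarrow> 'v" where
  "map_inv f \<equiv> inv_into UNIV f"

definition lin_comb2 ::
  "('f \<Rightarrow> 'v::ab_group_add \<Rightarrow> 'v) \<Rightarrow> 'f \<Rightarrow> ('v \<Rightarrow> 'v) \<Rightarrow> 'f \<Rightarrow> ('v \<Rightarrow> 'v) \<Rightarrow> 'v \<Rightarrow> 'v" where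
  "lin_comb2 scale b X c Y = (\<lambda>v. scale b (X v) + scale c (Y v))"

definition invertible_map :: "('f::field \<Rightarrow> 'v::ab_group_add \<Rightarrow> 'v) \<Rightarrow> ('v \<Rightarrow> 'v) \<Rightarrow> bool" where
  "invertible_map scale X \<longleftrightarrow> Vector_Spaces.linear scale scale X \<and> bij X"

definition equitable_rel ::
  "('f::field \<Rightarrow> 'v::ab_group_add \<Rightarrow> 'v) \<Rightarrow> 'f \<Rightarrow> ('v \<Rightarrow> 'v) \<Rightarrow> ('v \<Rightarrow> 'v) \<Rightarrow> bool" where
  "equitable_rel scale q X Y \<longleftrightarrow>
     lin_comb2 scale (q / (q - inverse q)) (X \<circ> Y) (- inverse q / (q - inverse q)) (Y \<circ> X) = id"

definition equitable_triple ::
  "('f::field \<Rightarrow> 'v::ab_group_add \<Rightarrow> 'v) \<Rightarrow> 'f \<Rightarrow> ('v \<Rightarrow> 'v) \<Rightarrow> ('v \<Rightarrow> 'v) \<Rightarrow> ('v \<Rightarrow> 'v) \<Rightarrow> bool" where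
  "equitable_triple scale q X Y Z \<longleftrightarrow>
     invertible_map scale X \<and> invertible_map scale Y \<and> invertible_map scale Z \<and>
     equitable_rel scale q X Y \<and> equitable_rel scale q Y Z \<and> equitable_rel scale q Z X"

text \<open>Names of the six flags \<open>[0]\<close>, \<open>[d]\<close>, \<open>[0\<^sup>*]\<close>, \<open>[d\<^sup>*]\<close>, \<open>[0\<^sup>+]\<close>, \<open>[d\<^sup>+]\<close>.\<close>

datatype flag_name = F0 | Fd | F0s | Fds | F0p | Fdp

text \<open>An element \<open>(x, X, y)\<close> is an arc from \<open>x\<close> to \<open>y\<close> with label \<open>X\<close>.\<close>

definition labelled_arcs ::
  "('f::field \<Rightarrow> 'v::ab_group_add \<Rightarrow> 'v) \<Rightarrow> 'f \<Rightarrow> ('v \<Rightarrow> 'v) \<Rightarrow>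
   ('v \<Rightarrow> 'v) \<Rightarrow> ('v \<Rightarrow> 'v) \<Rightarrow> ('v \<Rightarrow> 'v) \<Rightarrow> ('v \<Rightarrow> 'v) \<Rightarrow> ('v \<Rightarrow> 'v) \<Rightarrow> ('v \<Rightarrow> 'v) \<Rightarrow>
   (flag_name \<times> ('v \<Rightarrow> 'v) \<times> flag_name) set" where
  "labelled_arcs scale a A K B Kd Bd N Nd =
     {(F0, map_inv B, F0s),
      (Fd, map_inv K, F0s),
      (F0, map_inv Bd, Fds),
      (Fd, map_inv Kd, Fds),
      (F0p, lin_comb2 scale a A (- (a^2)) (map_inv B), F0),
      (F0p, lin_comb2 scale (inverse a) A (- (inverse a ^ 2)) (map_inv K), Fd),
      (Fdp, lin_comb2 scale a A (- (a^2)) (map_inv Bd), F0),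
      (Fdp, lin_comb2 scale (inverse a) A (- (inverse a ^ 2)) (map_inv Kd), Fd),
      (F0s, map_inv N, F0p),
      (Fds, map_inv Nd, Fdp)}"

end

theory Submission
  imports Defs
begin

text \<open>
  Reversing the ordering of the eigenspaces of \<open>A\<close> (which replaces \<open>a\<close> by \<open>a\<^sup>-\<^sup>1\<close>) or of
  \<open>A\<^sup>*\<close> permutes the four maps \<open>K, B, K\<^sup>\<down>, B\<^sup>\<down>\<close>, so it suffices to treat one of the four triples.
  Put \<open>X = K\<^sup>-\<^sup>1\<close> and \<open>Y = B\<^sup>-\<^sup>1\<close>.

  On the \<open>i\<close>-th summand of the split decomposition belonging to \<open>K\<close>, the map \<open>A\<close> is its \<open>i\<close>-th
  eigenvalue plus a map into the next summand, and \<open>A\<^sup>*\<close> is its \<open>i\<close>-th eigenvalue plus a map into the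
  previous summand. As all eigenvalues are combinations of \<open>q\<^bsup>d-2i\<^esup>\<close> and \<open>q\<^bsup>2i-d\<^esup>\<close>, the
  \<open>q\<close>-commutators of \<open>X\<close> with \<open>A\<close> and with \<open>A\<^sup>*\<close> are combinations of \<open>I\<close> and
  \<open>X\<^sup>2\<close> (lemmas \<open>split_map_A_relation\<close> and \<open>split_map_As_relation\<close>), and likewise for \<open>Y\<close>. The
  relation of \<open>A\<close> with \<open>X\<close> is already the third relation of the equitable triple.

  The other two relations are both equivalent to one quadratic relation between \<open>X\<close> and \<open>Y\<close>
  (lemma \<open>equitable_triple_of_quadratic_relation\<close>):
  \<open>(q - q\<^sup>-\<^sup>1) (X\<^sup>2 + a\<^sup>2 Y\<^sup>2) = (a\<^sup>2 q - q\<^sup>-\<^sup>1) Y X + (q - a\<^sup>2 q\<^sup>-\<^sup>1) X Y\<close>.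
  To prove it, let \<open>Q\<close> be the difference of the two sides. From the \<open>q\<close>-commutators one computes that
  \<open>Q A - q\<^sup>4 A Q\<close> and \<open>Q A\<^sup>* - q\<^sup>-\<^sup>4 A\<^sup>* Q\<close> are combinations of \<open>X Q\<close>, \<open>Y Q\<close>,
  \<open>Q X\<close> and \<open>Q Y\<close>. Hence the largest \<open>X, Y\<close>-invariant subspace of the kernel of \<open>Q\<close> is a
  submodule. It contains the first eigenspace of \<open>A\<^sup>*\<close>, on which \<open>X\<close> and \<open>Y\<close> are the same scalar,
  so it is everything and \<open>Q = 0\<close> (lemma \<open>split_maps_quadratic_relation\<close>).

  The remaining ingredients are classical. The defining relations of the algebra, read on
  eigenvectors, show that \<open>A\<^sup>*\<close> is tridiagonal on the eigenspaces of \<open>A\<close> and that the eigenvalues of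
  \<open>A\<^sup>*\<close> satisfy a three-term recurrence, which gives them the form needed above. The split
  decomposition follows from irreducibility (lemmas \<open>above_diagonal\<close> and \<open>split_decomposition\<close>). All
  invertibility statements hold because the maps are triangular with nonzero diagonal.
\<close>

section \<open>Linear maps and direct sums\<close>

text \<open>The vector space is a whole type with an arbitrary scalar multiplication. Definitions made
  directly in \<^locale>\<open>vector_space\<close> would also be instantiated for every interpretation of that
  locale; this copy of it keeps them local.\<close>

locale scalar_space = vector_space scale
  for scale :: "'f::field \<Rightarrow> 'v::ab_group_add \<Rightarrow> 'v"  (infixr \<open>*s\<close> 75)
begin

abbreviation lin :: "('v \<Rightarrow> 'v) \<Rightarrow> bool" where
  "lin f \<equiv> Vector_Spaces.linear scale scale f"

lemma lin_simps:
  assumes "lin f"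
  shows "f (x + y) = f x + f y" "f (c *s x) = c *s f x" "f 0 = 0" "f (- x) = - f x"
    "f (x - y) = f x - f y"
proof -
  have "module_hom scale scale f"
    using assms by (simp add: linear_iff_module_hom)
  then show "f (x + y) = f x + f y" "f (c *s x) = c *s f x" "f 0 = 0" "f (- x) = - f x"
    "f (x - y) = f x - f y"
    by (simp_all add: module_hom.add module_hom.scale module_hom.zero module_hom.neg module_hom.diff)
qed

lemma linI: "(\<And>x y. f (x + y) = f x + f y) \<Longrightarrow> (\<And>c x. f (c *s x) = c *s f x) \<Longrightarrow> lin f"
  by (simp add: linear_iff_module_hom module_hom_iff module_axioms)

lemma lin_compose: "lin f \<Longrightarrow> lin g \<Longrightarrow> lin (\<lambda>v. f (g v))"
  by (rule linI) (simp_all add: lin_simps)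

lemma lin_combine: "lin f \<Longrightarrow> lin g \<Longrightarrow> lin (\<lambda>v. b *s f v + c *s g v)"
  by (rule linI) (simp_all add: lin_simps scale_right_distrib algebra_simps)

lemma lin_scale: "lin (\<lambda>v. c *s v)"
  by (rule linI) (simp_all add: scale_right_distrib scale_scale mult.commute)

lemma lin_minus: "lin f \<Longrightarrow> lin g \<Longrightarrow> lin (\<lambda>v. f v - g v)"
  by (rule linI) (simp_all add: lin_simps scale_right_diff_distrib)

lemma subspace_preimage: "lin f \<Longrightarrow> subspace S \<Longrightarrow> subspace {v. f v \<in> S}"
  by (simp add: subspace_def lin_simps)

lemma lin_span_image: "lin f \<Longrightarrow> subspace S \<Longrightarrow> (\<And>w. w \<in> W \<Longrightarrow> f w \<in> S) \<Longrightarrow> v \<in> span W \<Longrightarrow> f v \<in> S"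
  using span_minimal[of W "{v. f v \<in> S}"] subspace_preimage[of f S] by blast

lemma lin_eq_on_span:
  assumes "lin f" "lin g" "\<And>w. w \<in> W \<Longrightarrow> f w = g w" "v \<in> span W"
  shows "f v = g v"
  using lin_span_image[OF lin_minus[OF assms(1,2)] subspace_single_0, of W v] assms(3,4) by auto

lemma subspace_sum_eq_span: "subspace_sum scale J W = span (\<Union>j\<in>J. W j)"
  by (simp add: subspace_sum_def)

lemma span_UN_components:
  assumes "finite I" "\<And>i. i \<in> I \<Longrightarrow> subspace (W i)" "v \<in> span (\<Union>i\<in>I. W i)"
  shows "\<exists>u. (\<forall>i\<in>I. u i \<in> W i) \<and> v = (\<Sum>i\<in>I. u i)"
proof -
  let ?S = "{v. \<exists>u. (\<forall>i\<in>I. u i \<in> W i) \<and> v = (\<Sum>i\<in>I. u i)}"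
  have "subspace ?S"
    unfolding subspace_def
  proof (intro conjI ballI allI)
    show "0 \<in> ?S"
      using assms(2) by (intro CollectI exI[of _ "\<lambda>_. 0"]) (simp add: subspace_0)
  next
    fix x y assume "x \<in> ?S" "y \<in> ?S"
    then obtain f g where "\<forall>i\<in>I. f i \<in> W i" "x = sum f I" "\<forall>i\<in>I. g i \<in> W i" "y = sum g I"
      by blast
    then show "x + y \<in> ?S"
      using assms(2) by (intro CollectI exI[of _ "\<lambda>i. f i + g i"]) (simp add: subspace_add sum.distrib)
  next
    fix c x assume "x \<in> ?S"
    then obtain f where "\<forall>i\<in>I. f i \<in> W i" "x = sum f I"
      by blast
    then show "c *s x \<in> ?S"
      using assms(2) by (intro CollectI exI[of _ "\<lambda>i. c *s f i"]) (simp add: subspace_scale scale_sum_right)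
  qed
  moreover have "(\<Union>i\<in>I. W i) \<subseteq> ?S"
  proof
    fix w assume "w \<in> (\<Union>i\<in>I. W i)"
    then obtain k where k: "k \<in> I" "w \<in> W k" by blast
    have "(\<Sum>i\<in>I. if i = k then w else 0) = w"
      using k assms(1) by simp
    then show "w \<in> ?S"
      using k assms(2) by (intro CollectI exI[of _ "\<lambda>i. if i = k then w else 0"]) (auto simp: subspace_0)
  qed
  ultimately show ?thesis
    using span_minimal assms(3) by blast
qed

definition decomposition :: "nat \<Rightarrow> (nat \<Rightarrow> 'v set) \<Rightarrow> bool" where
  "decomposition d W \<longleftrightarrow> (\<forall>i\<le>d. subspace (W i)) \<and> span (\<Union>i\<in>{..d}. W i) = UNIV \<and>
     (\<forall>i\<le>d. span (\<Union>j\<in>{..<i}. W j) \<inter> W i \<subseteq> {0})"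

lemma decomposition_subspace: "decomposition d W \<Longrightarrow> i \<le> d \<Longrightarrow> subspace (W i)"
  unfolding decomposition_def by blast

lemma decomposition_spans: "decomposition d W \<Longrightarrow> span (\<Union>i\<in>{..d}. W i) = UNIV"
  unfolding decomposition_def by blast

lemma decomposition_disjoint:
  "decomposition d W \<Longrightarrow> i \<le> d \<Longrightarrow> v \<in> span (\<Union>j\<in>{..<i}. W j) \<Longrightarrow> v \<in> W i \<Longrightarrow> v = 0"
  unfolding decomposition_def by (drule conjunct2, drule conjunct2) blast

lemma decomposition_independent:
  assumes "decomposition d W" "n \<le> Suc d" "\<And>i. i < n \<Longrightarrow> u i \<in> W i" "(\<Sum>i<n. u i) = 0" "i < n"
  shows "u i = 0"
  using assms(2-5)
proof (induction n arbitrary: i)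
  case 0
  then show ?case by simp
next
  case (Suc n)
  have "n \<le> d"
    using Suc.prems(1) by simp
  then have W: "subspace (W n)"
    using assms(1) by (rule decomposition_subspace[rotated])
  have "(\<Sum>i<n. u i) \<in> span (\<Union>j\<in>{..<n}. W j)"
    using Suc.prems(2) by (intro span_sum span_base) (auto intro!: bexI)
  moreover have sm: "(\<Sum>i<n. u i) = - u n"
    using Suc.prems(3) by (simp add: eq_neg_iff_add_eq_0)
  moreover have "- u n \<in> W n"
    using W Suc.prems(2) by (simp add: subspace_neg)
  ultimately have "- u n = 0"
    using decomposition_disjoint[OF assms(1) \<open>n \<le> d\<close>, of "- u n"] by simp
  then show ?case
    using Suc.IH[of i] Suc.prems sm by (cases "i = n") auto
qed

text \<open>Projections serve both to construct the map corresponding to a decomposition and to take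
  components of vectors along eigenspaces.\<close>

definition projections :: "nat \<Rightarrow> (nat \<Rightarrow> 'v set) \<Rightarrow> (nat \<Rightarrow> 'v \<Rightarrow> 'v) \<Rightarrow> bool" where
  "projections d W p \<longleftrightarrow> (\<forall>i\<le>d. \<forall>v. p i v \<in> W i) \<and> (\<forall>v. (\<Sum>i\<le>d. p i v) = v) \<and> (\<forall>i\<le>d. lin (p i)) \<and>
     (\<forall>i\<le>d. \<forall>j\<le>d. \<forall>w\<in>W i. p j w = (if j = i then w else 0))"

lemma projectionsD:
  assumes "projections d W p"
  shows "\<And>i v. i \<le> d \<Longrightarrow> p i v \<in> W i" "\<And>v. (\<Sum>i\<le>d. p i v) = v" "\<And>i. i \<le> d \<Longrightarrow> lin (p i)"
    "\<And>i j w. i \<le> d \<Longrightarrow> j \<le> d \<Longrightarrow> w \<in> W i \<Longrightarrow> p j w = (if j = i then w else 0)"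
  using assms by (simp_all only: projections_def)

lemma decomposition_projections:
  assumes dec: "decomposition d W"
  obtains p where "projections d W p"
proof -
  note sub = decomposition_subspace[OF dec]
  have "\<exists>u. (\<forall>i\<in>{..d}. u i \<in> W i) \<and> v = (\<Sum>i\<le>d. u i)" for v
    by (rule span_UN_components) (simp_all add: sub decomposition_spans[OF dec])
  then have "\<forall>v. \<exists>u. (\<forall>i\<in>{..d}. u i \<in> W i) \<and> v = (\<Sum>i\<le>d. u i)" ..
  from choice[OF this] obtain f where "\<forall>v. (\<forall>i\<in>{..d}. f v i \<in> W i) \<and> v = (\<Sum>i\<le>d. f v i)" ..
  note f = this[THEN spec, THEN conjunct1, rule_format] this[THEN spec, THEN conjunct2]
  have fW: "f v i \<in> W i" if "i \<le> d" for v i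
    using that by (intro f(1)) simp
  have uniq: "f v i = u i" if "v = (\<Sum>i\<le>d. u i)" "\<And>i. i \<le> d \<Longrightarrow> u i \<in> W i" "i \<le> d" for u v i
  proof -
    have "(\<Sum>i<Suc d. f v i - u i) = 0"
      unfolding sum_subtractf lessThan_Suc_atMost that(1)[symmetric] right_minus_eq
      by (simp flip: f(2)[of v])
    moreover have "\<And>i. i < Suc d \<Longrightarrow> f v i - u i \<in> W i"
      using fW that(2) sub by (simp add: subspace_diff less_Suc_eq_le)
    ultimately show ?thesis
      using decomposition_independent[OF dec, of "Suc d" "\<lambda>i. f v i - u i" i] that(3) by simp
  qed
  show ?thesis
  proof (rule that[of "\<lambda>i v. f v i"], unfold projections_def, intro conjI allI impI ballI)
    show "f v i \<in> W i" if "i \<le> d" for i v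
      using that by (rule fW)
    show "(\<Sum>i\<le>d. f v i) = v" for v
      by (rule f(2)[symmetric])
    show "lin (\<lambda>v. f v i)" if i: "i \<le> d" for i
    proof (rule linI)
      fix x y c
      have "x + y = (\<Sum>i\<le>d. f x i + f y i)"
        unfolding sum.distrib by (rule arg_cong2[of _ _ _ _ "(+)"]) (rule f(2))+
      then show "f (x + y) i = f x i + f y i"
        by (rule uniq[where u = "\<lambda>i. f x i + f y i"]) (simp_all add: subspace_add fW sub i)
      have "c *s x = (\<Sum>i\<le>d. c *s f x i)"
        unfolding scale_sum_right[symmetric] by (rule arg_cong[of _ _ "(*s) c"]) (rule f(2))
      then show "f (c *s x) i = c *s f x i"
        by (rule uniq[where u = "\<lambda>i. c *s f x i"]) (simp_all add: subspace_scale fW sub i)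
    qed
    show "f w j = (if j = i then w else 0)" if "i \<le> d" "j \<le> d" "w \<in> W i" for i j w
      by (rule uniq[where u = "\<lambda>j. if j = i then w else 0"]) (use that in \<open>auto simp: subspace_0 sub\<close>)
  qed
qed

text \<open>The description of the map by \<open>THE\<close> is met by exactly one map: a diagonal combination of the
  projections does act by the required scalars, and a linear map is determined by its restrictions to
  summands that span. The inverse is then the diagonal combination with the inverse scalars.\<close>

lemma corresponding_map_properties:
  assumes dec: "decomposition d W" and q: "q \<noteq> 0" and M: "M = corresponding_map scale q d W"
  shows "lin (map_inv M)"
    and "\<And>i w. i \<le> d \<Longrightarrow> w \<in> W i \<Longrightarrow> map_inv M w = q powi (2 * int i - int d) *s w"
    and "bij (map_inv M)"
proof -
  obtain p where "projections d W p"
    by (rule decomposition_projections[OF dec])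
  note p = projectionsD[OF this]
  define D where "D c v = (\<Sum>i\<le>d. c i *s p i v)" for c :: "nat \<Rightarrow> 'f" and v
  have linD: "lin (D c)" for c
  proof (rule linI)
    show "D c (x + y) = D c x + D c y" for x y
      unfolding D_def sum.distrib[symmetric]
      by (rule sum.cong) (simp_all add: lin_simps(1)[OF p(3)] scale_right_distrib)
    show "D c (b *s x) = b *s D c x" for b x
      unfolding D_def scale_sum_right
      by (rule sum.cong) (simp_all add: lin_simps(2)[OF p(3)] mult.commute)
  qed
  have DW: "D c w = c i *s w" if "i \<le> d" "w \<in> W i" for c i w
  proof -
    have "D c w = (\<Sum>j\<le>d. if j = i then c i *s w else 0)"
      unfolding D_def using p(4)[OF that(1) _ that(2)] by (intro sum.cong) auto
    then show ?thesis using that by simp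
  qed
  have ext: "f = g" if "lin f" "lin g" "\<And>i w. i \<le> d \<Longrightarrow> w \<in> W i \<Longrightarrow> f w = g w" for f g
  proof
    fix v
    show "f v = g v"
      by (rule lin_eq_on_span[OF that(1,2), of "\<Union>i\<in>{..d}. W i"])
        (use that(3) in \<open>auto simp: decomposition_spans[OF dec]\<close>)
  qed
  define k where "k i = q powi (int d - 2 * int i)" for i
  define l where "l i = q powi (2 * int i - int d)" for i
  have kl: "k i * l i = 1" for i
    using q by (simp add: k_def l_def flip: power_int_add)
  have Mk: "M = D k"
    unfolding M corresponding_map_def
  proof (rule the_equality)
    show "lin (D k) \<and> (\<forall>i\<le>d. \<forall>w\<in>W i. D k w = q powi (int d - 2 * int i) *s w)"
      by (simp add: k_def DW linD)
  next
    fix f assume "lin f \<and> (\<forall>i\<le>d. \<forall>w\<in>W i. f w = q powi (int d - 2 * int i) *s w)"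
    then show "f = D k"
      by (intro ext[OF _ linD]) (auto simp: k_def DW)
  qed
  have inv1: "(\<lambda>v. D k (D l v)) = (\<lambda>v. 1 *s v)"
    using kl by (intro ext[OF lin_compose[OF linD linD] lin_scale]) (simp add: DW lin_simps(2)[OF linD] mult.commute)
  have inv2: "(\<lambda>v. D l (D k v)) = (\<lambda>v. 1 *s v)"
    using kl by (intro ext[OF lin_compose[OF linD linD] lin_scale]) (simp add: DW lin_simps(2)[OF linD] mult.commute)
  have eq: "map_inv M = D l"
    unfolding Mk using fun_cong[OF inv1] fun_cong[OF inv2] by (intro inv_equality) simp_all
  show "lin (map_inv M)" "\<And>i w. i \<le> d \<Longrightarrow> w \<in> W i \<Longrightarrow> map_inv M w = q powi (2 * int i - int d) *s w"
    unfolding eq by (simp_all add: l_def DW linD)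
  show "bij (map_inv M)"
    unfolding eq using inv1 inv2 by (intro o_bij[of "D k"]) (auto simp: fun_eq_iff)
qed

text \<open>Along the flag of partial sums of the \<open>W i\<close> the map is upper triangular, with the nonzero
  entries \<open>c i\<close> on the diagonal. Injectivity descends the flag, surjectivity climbs it.\<close>

lemma triangular_bij:
  fixes d :: nat
  assumes M: "lin M" and span: "span (\<Union>i\<in>{..d}. W i) = UNIV" 
    and W: "\<And>i. i \<le> d \<Longrightarrow> subspace (W i)"
    and tri: "\<And>i w. i \<le> d \<Longrightarrow> w \<in> W i \<Longrightarrow> M w - c i *s w \<in> span (\<Union>j\<in>{..<i}. W j)"
    and c: "\<And>i. i \<le> d \<Longrightarrow> c i \<noteq> 0"
  shows "bij M"
proof -
  let ?F = "\<lambda>n. span (\<Union>j\<in>{..<n}. W j)"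
  have mono: "?F m \<subseteq> ?F n" if "m \<le> n" for m n
    using that by (intro span_mono UN_mono) auto
  have step: "M v - c i *s v \<in> ?F i" if i: "i \<le> d" and v: "v \<in> ?F (Suc i)" for i v
  proof (rule lin_span_image[OF lin_minus[OF M lin_scale] subspace_span _ v])
    fix w assume "w \<in> (\<Union>j\<in>{..<Suc i}. W j)"
    then obtain j where j: "j \<le> i" "w \<in> W j" by (auto simp: less_Suc_eq_le)
    show "M w - c i *s w \<in> ?F i"
    proof (cases "j = i")
      case True
      then show ?thesis using tri i j by simp
    next
      case False
      have "M w - c j *s w \<in> ?F i"
        using tri[of j w] j i mono[of j i] by auto
      moreover have "w \<in> ?F i"
        using j False by (intro span_base) auto
      ultimately have "(M w - c j *s w) + (c j - c i) *s w \<in> ?F i"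
        by (intro span_add span_scale)
      then show ?thesis by (simp add: scale_left_diff_distrib)
    qed
  qed
  have F0: "?F 0 = {0}" and Fd: "?F (Suc d) = UNIV"
    using span by (simp_all add: lessThan_Suc_atMost)
  have "v = 0" if "M v = 0" for v
  proof -
    have "v \<in> ?F (Suc d - n)" if "n \<le> Suc d" for n
      using that
    proof (induction n)
      case 0
      then show ?case using Fd by simp
    next
      case (Suc n)
      define i where "i = d - n"
      have i: "i \<le> d" "Suc d - n = Suc i" "Suc d - Suc n = i"
        using Suc.prems by (auto simp: i_def)
      have "M v - c i *s v \<in> ?F i"
        using step[of i v] Suc i by simp
      then have "- c i *s v \<in> ?F i" using \<open>M v = 0\<close> by simp
      then have "(- inverse (c i)) *s (- c i *s v) \<in> ?F i" by (rule span_scale)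
      then show ?case using c[OF i(1)] i by simp
    qed
    from this[of "Suc d"] show "v = 0" using F0 by simp
  qed
  note kernel = this
  have "inj M"
  proof (rule injI)
    fix x y assume "M x = M y"
    then have "M (x - y) = 0" by (simp add: lin_simps(5)[OF M])
    from kernel[OF this] show "x = y" by simp
  qed
  moreover have "?F n \<subseteq> range M" if "n \<le> Suc d" for n
    using that
  proof (induction n)
    case 0
    show ?case unfolding F0 using lin_simps(3)[OF M, symmetric] by (simp add: range_eqI)
  next
    case (Suc n)
    show ?case
    proof
      fix v assume v: "v \<in> ?F (Suc n)"
      have "M v - c n *s v \<in> range M"
        using step[OF _ v] Suc.IH Suc.prems by (meson Suc_leD Suc_le_mono subsetD)
      then obtain u where "M v - c n *s v = M u" by blast
      then have *: "M (v - u) = c n *s v" by (simp add: lin_simps(5)[OF M] algebra_simps)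
      have "M (inverse (c n) *s (v - u)) = v"
        using c[of n] Suc.prems by (simp add: lin_simps(2)[OF M] *)
      then show "v \<in> range M" by (rule range_eqI[OF sym])
    qed
  qed
  from this[of "Suc d"] have "range M = UNIV"
    unfolding Fd by auto
  ultimately show ?thesis
    by (simp add: bij_betw_def top_unique)
qed

lemma subspace_eigenspace: "lin T \<Longrightarrow> subspace (eigenspace scale T c)"
  by (simp add: subspace_def eigenspace_def lin_simps scale_right_distrib mult.commute)

text \<open>Applying \<open>T - t j\<close> removes the \<open>j\<close>-th summand from the sum and multiplies \<open>v\<close> by a
  nonzero scalar, so the eigenspaces can be discarded one at a time.\<close>

lemma eigenspace_disjoint_sum:
  assumes T: "lin T" and "finite J" "v \<in> span (\<Union>j\<in>J. eigenspace scale T (t j))" "T v = c *s v" "c \<notin> t ` J"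
  shows "v = 0"
  using assms(2-5)
proof (induction J arbitrary: v)
  case empty
  then show ?case by simp
next
  case (insert j J)
  let ?S = "span (\<Union>j\<in>J. eigenspace scale T (t j))"
  have "T v - t j *s v \<in> ?S"
  proof (rule lin_span_image[OF lin_minus[OF T lin_scale] subspace_span _ insert.prems(1)])
    fix w assume "w \<in> (\<Union>j\<in>insert j J. eigenspace scale T (t j))"
    then consider "T w = t j *s w" | i where "i \<in> J" "T w = t i *s w"
      by (auto simp: eigenspace_def)
    then show "T w - t j *s w \<in> ?S"
    proof cases
      case 1
      then show ?thesis by (simp add: span_zero)
    next
      case 2
      then have "w \<in> ?S" by (intro span_base) (auto simp: eigenspace_def)
      then show ?thesis using 2 by (simp add: span_diff span_scale)
    qed
  qed
  then have "(c - t j) *s v \<in> ?S"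
    using insert.prems(2) by (simp add: scale_left_diff_distrib)
  then have "inverse (c - t j) *s ((c - t j) *s v) \<in> ?S" by (rule span_scale)
  moreover have "c - t j \<noteq> 0" using insert.prems(3) by auto
  ultimately show ?case
    using insert.IH[of v] insert.prems by simp
qed

lemma eigenspace_decomposition:
  assumes T: "lin T" and diag: "diagonalizable scale T" and ord: "eigenvalue_ordering scale T d t"
  shows "decomposition d (\<lambda>i. eigenspace scale T (t i))"
  unfolding decomposition_def
proof (intro conjI allI impI)
  show "subspace (eigenspace scale T (t i))" for i
    using T by (rule subspace_eigenspace)
  obtain S where S: "independent S" "span S = UNIV" "\<forall>v\<in>S. \<exists>c. T v = c *s v"
    using diag unfolding diagonalizable_def by blast
  have "S \<subseteq> (\<Union>i\<in>{..d}. eigenspace scale T (t i))"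
  proof
    fix v assume v: "v \<in> S"
    then obtain c where c: "T v = c *s v" using S by blast
    have "v \<noteq> 0" using v S(1) dependent_zero by blast
    then have "c \<in> t ` {0..d}"
      using c ord unfolding eigenvalue_ordering_def is_eigenvalue_def by blast
    then show "v \<in> (\<Union>i\<in>{..d}. eigenspace scale T (t i))"
      using c by (auto simp: eigenspace_def)
  qed
  then show "span (\<Union>i\<in>{..d}. eigenspace scale T (t i)) = UNIV"
    using span_mono S(2) by blast
  show "span (\<Union>j\<in>{..<i}. eigenspace scale T (t j)) \<inter> eigenspace scale T (t i) \<subseteq> {0}" if "i \<le> d" for i
  proof
    fix v assume v: "v \<in> span (\<Union>j\<in>{..<i}. eigenspace scale T (t j)) \<inter> eigenspace scale T (t i)"
    have "t i \<noteq> t j" if "j < i" for j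
      using ord that \<open>i \<le> d\<close> inj_onD[of t "{0..d}" i j] by (auto simp: eigenvalue_ordering_def)
    then have "t i \<notin> t ` {..<i}" by auto
    then have "v = 0"
      using v by (intro eigenspace_disjoint_sum[OF T, of "{..<i}" v t "t i"]) (auto simp: eigenspace_def)
    then show "v \<in> {0}" by simp
  qed
qed

end

section \<open>A quadratic relation\<close>

context scalar_space
begin

text \<open>For the coefficients used below, the vanishing of this map is the relation between the inverses of
  the two split maps; it plays the part of the Bockting-Conder relation between \<open>K\<close> and \<open>B\<close>.\<close>

definition quadratic :: "'f \<Rightarrow> 'f \<Rightarrow> 'f \<Rightarrow> 'f \<Rightarrow> ('v \<Rightarrow> 'v) \<Rightarrow> ('v \<Rightarrow> 'v) \<Rightarrow> 'v \<Rightarrow> 'v" where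
  "quadratic e1 e2 e3 e4 X Y v = e1 *s X (X v) + e2 *s Y (Y v) - e3 *s Y (X v) - e4 *s X (Y v)"

lemma lin_quadratic: "lin X \<Longrightarrow> lin Y \<Longrightarrow> lin (quadratic e1 e2 e3 e4 X Y)"
  by (rule linI) (simp_all add: quadratic_def lin_simps scale_right_distrib scale_right_diff_distrib mult.commute)

text \<open>Moving \<open>T\<close> to the left through a quadratic expression in \<open>X\<close> and \<open>Y\<close> leaves an
  error with terms of degree one and three. The first two coefficient conditions kill the terms of
  degree one; the others, one for each word of length three, say that the terms of degree three lie
  in the ideal generated by the quadratic expression, with multipliers \<open>\<alpha>\<close>, \<open>\<beta>\<close>,
  \<open>\<gamma>\<close>, \<open>\<delta>\<close>.\<close>

lemma quadratic_commutation:
  assumes lin: "lin T" "lin X" "lin Y"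
    and XT: "\<And>v. X (T v) = \<rho> *s T (X v) + f *s v + g *s X (X v)"
    and YT: "\<And>v. Y (T v) = \<rho> *s T (Y v) + f' *s v + g' *s Y (Y v)"
    and X1: "e1 * (\<rho> + 1) * f - e3 * \<rho> * f' - e4 * f' = 0"
    and Y1: "e2 * (\<rho> + 1) * f' - e3 * f - e4 * \<rho> * f = 0"
    and XXX: "e1 * (\<rho> + 1) * g = \<alpha> * e1 + \<gamma> * e1"
    and YYY: "e2 * (\<rho> + 1) * g' = \<beta> * e2 + \<delta> * e2"
    and YYX: "- (e3 * \<rho> * g') = \<gamma> * e2 - \<beta> * e3"
    and YXX: "- (e3 * g) = \<beta> * e1 - \<gamma> * e3"
    and XXY: "- (e4 * \<rho> * g) = \<delta> * e1 - \<alpha> * e4"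
    and XYY: "- (e4 * g') = \<alpha> * e2 - \<delta> * e4"
    and XYX: "- (\<alpha> * e3) - \<gamma> * e4 = 0"
    and YXY: "- (\<beta> * e4) - \<delta> * e3 = 0"
  defines "Q \<equiv> quadratic e1 e2 e3 e4 X Y"
  shows "Q (T v) = (\<rho> * \<rho>) *s T (Q v) + \<alpha> *s X (Q v) + \<beta> *s Y (Q v) + \<gamma> *s Q (X v) + \<delta> *s Q (Y v)"
proof -
  note linear_rules = lin_simps(1,2,5)[OF lin(1)] lin_simps(1,2,5)[OF lin(2)] lin_simps(1,2,5)[OF lin(3)]
    scale_right_distrib scale_right_diff_distrib
  have "X (X (T v)) = (\<rho> * \<rho>) *s T (X (X v)) + ((\<rho> + 1) * f) *s X v + ((\<rho> + 1) * g) *s X (X (X v))"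
    "Y (Y (T v)) = (\<rho> * \<rho>) *s T (Y (Y v)) + ((\<rho> + 1) * f') *s Y v + ((\<rho> + 1) * g') *s Y (Y (Y v))"
    "Y (X (T v)) = (\<rho> * \<rho>) *s T (Y (X v)) + (\<rho> * f') *s X v + f *s Y v
       + (\<rho> * g') *s Y (Y (X v)) + g *s Y (X (X v))"
    "X (Y (T v)) = (\<rho> * \<rho>) *s T (X (Y v)) + (\<rho> * f) *s Y v + f' *s X v
       + (\<rho> * g) *s X (X (Y v)) + g' *s X (Y (Y v))"
    by (simp_all add: XT YT linear_rules scale_left_distrib distrib_right)
  then have "Q (T v) = (\<rho> * \<rho>) *s T (Q v) + (e1 * (\<rho> + 1) * f - e3 * \<rho> * f' - e4 * f') *s X v
      + (e2 * (\<rho> + 1) * f' - e3 * f - e4 * \<rho> * f) *s Y v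
      + (e1 * (\<rho> + 1) * g) *s X (X (X v)) + (e2 * (\<rho> + 1) * g') *s Y (Y (Y v))
      + (- (e3 * \<rho> * g')) *s Y (Y (X v)) + (- (e3 * g)) *s Y (X (X v))
      + (- (e4 * \<rho> * g)) *s X (X (Y v)) + (- (e4 * g')) *s X (Y (Y v))"
    by (simp add: Q_def quadratic_def linear_rules algebra_simps)
  moreover have "(\<rho> * \<rho>) *s T (Q v) + \<alpha> *s X (Q v) + \<beta> *s Y (Q v) + \<gamma> *s Q (X v) + \<delta> *s Q (Y v)
      = (\<rho> * \<rho>) *s T (Q v) + (\<alpha> * e1 + \<gamma> * e1) *s X (X (X v)) + (\<beta> * e2 + \<delta> * e2) *s Y (Y (Y v))
      + (\<gamma> * e2 - \<beta> * e3) *s Y (Y (X v)) + (\<beta> * e1 - \<gamma> * e3) *s Y (X (X v))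
      + (\<delta> * e1 - \<alpha> * e4) *s X (X (Y v)) + (\<alpha> * e2 - \<delta> * e4) *s X (Y (Y v))
      + (- (\<alpha> * e3) - \<gamma> * e4) *s X (Y (X v)) + (- (\<beta> * e4) - \<delta> * e3) *s Y (X (Y v))"
    by (simp add: Q_def quadratic_def linear_rules algebra_simps)
  ultimately show ?thesis
    unfolding X1 Y1 XXX YYY YYX YXX XXY XYY XYX YXY by (simp only: scale_zero_left add_0_right)
qed

text \<open>The largest subspace of the kernel of \<open>Q\<close> that is invariant under \<open>X\<close> and
  \<open>Y\<close>. The kernel itself need not be invariant under a map \<open>T\<close> that commutes with
  \<open>Q\<close> only up to terms such as \<open>Q X\<close>, but this subspace is.\<close>

definition null_core :: "('v \<Rightarrow> 'v) \<Rightarrow> ('v \<Rightarrow> 'v) \<Rightarrow> ('v \<Rightarrow> 'v) \<Rightarrow> 'v set" where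
  "null_core Q X Y = span (\<Union>{S. subspace S \<and> S \<subseteq> {v. Q v = 0} \<and> X ` S \<subseteq> S \<and> Y ` S \<subseteq> S})"

lemma null_core_greatest:
  assumes "subspace S" "S \<subseteq> {v. Q v = 0}" "X ` S \<subseteq> S" "Y ` S \<subseteq> S"
  shows "S \<subseteq> null_core Q X Y"
proof -
  have "S \<subseteq> \<Union>{S. subspace S \<and> S \<subseteq> {v. Q v = 0} \<and> X ` S \<subseteq> S \<and> Y ` S \<subseteq> S}"
    using assms by blast
  then show ?thesis
    unfolding null_core_def using span_superset by blast
qed

lemma null_core_properties:
  assumes lin: "lin Q" "lin X" "lin Y" and v: "v \<in> null_core Q X Y"
  shows "Q v = 0" "X v \<in> null_core Q X Y" "Y v \<in> null_core Q X Y"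
proof -
  have "Q v \<in> {0}"
    by (rule lin_span_image[OF lin(1) subspace_single_0 _ v[unfolded null_core_def]]) blast
  then show "Q v = 0" by simp
  show "X v \<in> null_core Q X Y"
    unfolding null_core_def
    by (rule lin_span_image[OF lin(2) subspace_span _ v[unfolded null_core_def]]) (rule span_base, blast)
  show "Y v \<in> null_core Q X Y"
    unfolding null_core_def
    by (rule lin_span_image[OF lin(3) subspace_span _ v[unfolded null_core_def]]) (rule span_base, blast)
qed

text \<open>The sum of the null core and its image under \<open>T\<close> is again invariant under \<open>X\<close> and
  \<open>Y\<close> and killed by \<open>Q\<close>, hence it is no larger than the null core.\<close>

lemma null_core_invariant:
  assumes lin: "lin Q" "lin X" "lin Y" "lin T"
    and XT: "\<And>v. X (T v) = \<rho> *s T (X v) + f *s v + g *s X (X v)"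
    and YT: "\<And>v. Y (T v) = \<rho> *s T (Y v) + f' *s v + g' *s Y (Y v)"
    and QT: "\<And>v. Q (T v) = \<sigma> *s T (Q v) + \<alpha> *s X (Q v) + \<beta> *s Y (Q v) + \<gamma> *s Q (X v) + \<delta> *s Q (Y v)"
  shows "T ` null_core Q X Y \<subseteq> null_core Q X Y"
proof -
  let ?N = "null_core Q X Y"
  let ?S = "span (?N \<union> T ` ?N)"
  note N = null_core_properties[OF lin(1-3)]
  have base: "v \<in> ?S" "T v \<in> ?S" if "v \<in> ?N" for v
    using that by (auto intro: span_base)
  have "?S \<subseteq> ?N"
  proof (rule null_core_greatest)
    show "?S \<subseteq> {v. Q v = 0}"
    proof
      fix v assume v: "v \<in> ?S"
      have "Q v \<in> {0}"
        by (rule lin_span_image[OF lin(1) subspace_single_0 _ v])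
          (auto simp: QT N lin_simps(3)[OF lin(2)] lin_simps(3)[OF lin(3)] lin_simps(3)[OF lin(4)])
      then show "v \<in> {v. Q v = 0}" by simp
    qed
    show "X ` ?S \<subseteq> ?S"
    proof safe
      fix v assume v: "v \<in> ?S"
      show "X v \<in> ?S"
      proof (rule lin_span_image[OF lin(2) subspace_span _ v])
        fix w assume "w \<in> ?N \<union> T ` ?N"
        then consider "w \<in> ?N" | u where "u \<in> ?N" "w = T u" by blast
        then show "X w \<in> ?S"
        proof cases
          case 1
          then show ?thesis by (intro base(1) N)
        next
          case 2
          then show ?thesis
            by (simp only: XT) (intro span_add span_scale base N)
        qed
      qed
    qed
    show "Y ` ?S \<subseteq> ?S"
    proof safe
      fix v assume v: "v \<in> ?S"
      show "Y v \<in> ?S"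
      proof (rule lin_span_image[OF lin(3) subspace_span _ v])
        fix w assume "w \<in> ?N \<union> T ` ?N"
        then consider "w \<in> ?N" | u where "u \<in> ?N" "w = T u" by blast
        then show "Y w \<in> ?S"
        proof cases
          case 1
          then show ?thesis by (intro base(1) N)
        next
          case 2
          then show ?thesis
            by (simp only: YT) (intro span_add span_scale base N)
        qed
      qed
    qed
  qed (rule subspace_span)
  then have "T v \<in> ?N" if "v \<in> ?N" for v
    using base(2)[OF that] by (rule subsetD)
  then show ?thesis
    by (rule image_subsetI)
qed

text \<open>Both \<open>A\<close> and \<open>As\<close> commute with the quadratic expression up to the ideal that it
  generates, so its null core is invariant under both. The null core is nonzero because
  \<open>X\<close> and \<open>Y\<close> agree and are scalar on \<open>S\<close> and the four coefficients cancel when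
  \<open>X\<close> and \<open>Y\<close> are replaced by one scalar. Irreducibility makes it the whole space.\<close>

lemma split_maps_quadratic_relation:
  assumes lin: "lin A" "lin As" "lin X" "lin Y"
    and irreducible: "\<And>W. subspace W \<Longrightarrow> A ` W \<subseteq> W \<Longrightarrow> As ` W \<subseteq> W \<Longrightarrow> W = {0} \<or> W = UNIV"
    and q: "q \<noteq> 0" and a: "a \<noteq> 0" "a\<^sup>2 \<noteq> 1"
    and XA: "\<And>v. q *s A (X v) - inverse q *s X (A v) = (q - inverse q) *s (a *s v + inverse a *s X (X v))"
    and YA: "\<And>v. q *s A (Y v) - inverse q *s Y (A v) = (q - inverse q) *s (inverse a *s v + a *s Y (Y v))"
    and XAs: "\<And>v. q *s X (As v) - inverse q *s As (X v) = (q - inverse q) *s (b *s v + c *s X (X v))"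
    and YAs: "\<And>v. q *s Y (As v) - inverse q *s As (Y v) = (q - inverse q) *s (b *s v + c *s Y (Y v))"
    and common: "subspace S" "S \<noteq> {0}" "\<And>v. v \<in> S \<Longrightarrow> X v = k *s v" "\<And>v. v \<in> S \<Longrightarrow> Y v = k *s v"
  shows "quadratic (q - inverse q) (a\<^sup>2 * (q - inverse q)) (a\<^sup>2 * q - inverse q) (q - a\<^sup>2 * inverse q) X Y v = 0"
proof -
  define p where "p = inverse q"
  have p: "p \<noteq> 0" "q * p = 1" using q by (auto simp: p_def)
  define e1 e2 e3 e4 where e: "e1 = q - p" "e2 = a\<^sup>2 * (q - p)" "e3 = a\<^sup>2 * q - p" "e4 = q - a\<^sup>2 * p"
  let ?Q = "quadratic e1 e2 e3 e4 X Y"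
  have linQ: "lin ?Q" using lin by (intro lin_quadratic)
  have solve: "y = (q\<^sup>2) *s x - (q * e1) *s z" if "q *s x - p *s y = e1 *s z" for x y z
  proof -
    have "p *s y = q *s x - e1 *s z" using that by (simp add: algebra_simps)
    then have "q *s (p *s y) = q *s (q *s x - e1 *s z)" by simp
    then show ?thesis using p by (simp add: scale_right_diff_distrib power2_eq_square)
  qed
  have solve': "y = (p\<^sup>2) *s x + (p * e1) *s z" if "q *s y - p *s x = e1 *s z" for x y z
  proof -
    have "q *s y = p *s x + e1 *s z" using that by (simp add: algebra_simps)
    then have "p *s (q *s y) = p *s (p *s x + e1 *s z)" by simp
    then show ?thesis using p by (simp add: scale_right_distrib power2_eq_square mult.commute)
  qed
  have A1: "X (A v) = q\<^sup>2 *s A (X v) + (- (q * e1 * a)) *s v + (- (q * e1 * inverse a)) *s X (X v)" for v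
    using solve[OF XA[of v, folded p_def, folded e(1)]] by (simp add: scale_right_distrib mult.assoc)
  have A2: "Y (A v) = q\<^sup>2 *s A (Y v) + (- (q * e1 * inverse a)) *s v + (- (q * e1 * a)) *s Y (Y v)" for v
    using solve[OF YA[of v, folded p_def, folded e(1)]] by (simp add: scale_right_distrib mult.assoc)
  have As1: "X (As v) = p\<^sup>2 *s As (X v) + (p * e1 * b) *s v + (p * e1 * c) *s X (X v)" for v
    using solve'[OF XAs[of v, folded p_def, folded e(1)]] by (simp add: scale_right_distrib mult.assoc add.assoc)
  have As2: "Y (As v) = p\<^sup>2 *s As (Y v) + (p * e1 * b) *s v + (p * e1 * c) *s Y (Y v)" for v
    using solve'[OF YAs[of v, folded p_def, folded e(1)]] by (simp add: scale_right_distrib mult.assoc add.assoc)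
  have a1: "1 - a\<^sup>2 \<noteq> 0" using a by simp
  \<comment> \<open>The multipliers below come from solving the coefficient conditions as a linear system;
    the determinant of the two equations for each pair is a multiple of \<open>1 - a\<^sup>2\<close>.\<close>
  define r s where "r = inverse a" and "s = inverse (1 - a\<^sup>2)"
  have units: "q * p = 1" "a * r = 1" "s * (1 - a\<^sup>2) = 1"
    using p a a1 by (simp_all add: r_def s_def)
  note A1 = A1[folded r_def] and A2 = A2[folded r_def]
  have QA: "?Q (A v) = (q\<^sup>2 * q\<^sup>2) *s A (?Q v) + (- (q * e1) * (q * e4 * r * s)) *s X (?Q v)
      + (q * e1 * (q * a * e3 * s)) *s Y (?Q v) + (q * e1 * (q * e3 * r * s)) *s ?Q (X v)
      + (- (q * e1) * (q * a * e4 * s)) *s ?Q (Y v)" for v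
    by (rule quadratic_commutation[OF lin(1,3,4) A1 A2]; unfold e)
      ((use units in Groebner_Basis.algebra) | simp add: mult_ac)+
  have QAs: "?Q (As v) = (p\<^sup>2 * p\<^sup>2) *s As (?Q v) + (p * e1 * c * (p * e4 * s)) *s X (?Q v)
      + (- (p * e1 * c) * (p * e3 * s)) *s Y (?Q v) + (- (p * e1 * c) * (p * e3 * s)) *s ?Q (X v)
      + (p * e1 * c * (p * e4 * s)) *s ?Q (Y v)" for v
    by (rule quadratic_commutation[OF lin(2,3,4) As1 As2]; unfold e)
      ((use units in Groebner_Basis.algebra) | simp add: mult_ac)+
  have "A ` null_core ?Q X Y \<subseteq> null_core ?Q X Y" "As ` null_core ?Q X Y \<subseteq> null_core ?Q X Y"
    using null_core_invariant[OF linQ lin(3,4,1) A1 A2 QA] null_core_invariant[OF linQ lin(3,4,2) As1 As2 QAs] .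
  then have "null_core ?Q X Y = {0} \<or> null_core ?Q X Y = UNIV"
    by (intro irreducible) (auto simp: null_core_def)
  moreover have "S \<subseteq> null_core ?Q X Y"
  proof (rule null_core_greatest[OF common(1)])
    have "e1 + e2 - e3 - e4 = 0" by (simp add: e algebra_simps)
    have "?Q v = 0" if "v \<in> S" for v
    proof -
      have "?Q v = ((e1 + e2 - e3 - e4) * (k * k)) *s v"
        using that common(3,4) lin
        by (simp add: quadratic_def lin_simps scale_left_distrib scale_left_diff_distrib algebra_simps)
      then show ?thesis by (simp add: \<open>e1 + e2 - e3 - e4 = 0\<close>)
    qed
    then show "S \<subseteq> {v. ?Q v = 0}" by blast
    show "X ` S \<subseteq> S" "Y ` S \<subseteq> S"
      using common subspace_scale by auto
  qed
  ultimately have "null_core ?Q X Y = UNIV"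
    using common(2) subspace_0[OF common(1)] by auto
  then show ?thesis
    using null_core_properties(1)[OF linQ lin(3,4), of v] by (simp add: e p_def)
qed

end

section \<open>The split decomposition\<close>

lemma powi_add_2:
  fixes q :: "'f::field"
  shows "q \<noteq> 0 \<Longrightarrow> q powi (m + 2) = q * q * q powi m"
  by (simp add: power_int_add power2_eq_square mult.commute)

lemma UN_reverse: "(\<Union>i\<in>{..d::nat}. W (d - i)) = (\<Union>i\<in>{..d}. W i)"
proof -
  have "(\<lambda>i. d - i) ` {..d} = {..d}"
  proof (intro equalityI subsetI)
    fix k assume "k \<in> {..d}"
    then show "k \<in> (\<lambda>i. d - i) ` {..d}" by (intro image_eqI[of _ _ "d - k"]) auto
  qed auto
  then show ?thesis by (metis image_image)
qed

lemma acts_tridiagonally_reverse: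
  assumes "acts_tridiagonally scale d T W"
  shows "acts_tridiagonally scale d T (\<lambda>i. W (d - i))"
  unfolding acts_tridiagonally_def
proof (intro allI impI)
  fix i assume i: "i \<le> d"
  have "{j. j \<le> d \<and> d - i \<le> j + 1 \<and> j \<le> d - i + 1} = (\<lambda>j. d - j) ` {j. j \<le> d \<and> i \<le> j + 1 \<and> j \<le> i + 1}"
  proof (intro equalityI subsetI)
    fix k assume "k \<in> {j. j \<le> d \<and> d - i \<le> j + 1 \<and> j \<le> d - i + 1}"
    then show "k \<in> (\<lambda>j. d - j) ` {j. j \<le> d \<and> i \<le> j + 1 \<and> j \<le> i + 1}"
      using i by (intro image_eqI[of _ _ "d - k"]) auto
  qed (use i in auto)
  then show "T ` W (d - i) \<subseteq> subspace_sum scale {j. j \<le> d \<and> i \<le> j + 1 \<and> j \<le> i + 1} (\<lambda>j. W (d - j))"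
    using assms[unfolded acts_tridiagonally_def, rule_format, of "d - i"]
    by (simp add: subspace_sum_def image_image)
qed

text \<open>An irreducible pair of diagonalizable maps, each tridiagonal on the ordered eigenspaces of the
  other. The axioms do not change when either ordering is reversed, so every result below holds for
  all four choices of orderings.\<close>

locale tridiagonal_pair = scalar_space scale
  for scale :: "'f::field \<Rightarrow> 'v::ab_group_add \<Rightarrow> 'v"  (infixr \<open>*s\<close> 75) +
  fixes A As :: "'v \<Rightarrow> 'v" and d :: nat and \<theta> \<theta>s :: "nat \<Rightarrow> 'f"
  assumes lin_A: "lin A" and lin_As: "lin As"
    and inj: "inj_on \<theta> {..d}" "inj_on \<theta>s {..d}"
    and spans: "span (\<Union>i\<in>{..d}. eigenspace scale A (\<theta> i)) = UNIV"
      "span (\<Union>i\<in>{..d}. eigenspace scale As (\<theta>s i)) = UNIV"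
    and eigenvalues: "\<And>i. i \<le> d \<Longrightarrow> is_eigenvalue scale A (\<theta> i)" "\<And>i. i \<le> d \<Longrightarrow> is_eigenvalue scale As (\<theta>s i)"
    and tridiagonal: "acts_tridiagonally scale d As (\<lambda>i. eigenspace scale A (\<theta> i))"
      "acts_tridiagonally scale d A (\<lambda>i. eigenspace scale As (\<theta>s i))"
    and irreducible: "\<And>W. subspace W \<Longrightarrow> A ` W \<subseteq> W \<Longrightarrow> As ` W \<subseteq> W \<Longrightarrow> W = {0} \<or> W = UNIV"
begin

abbreviation V where "V i \<equiv> eigenspace scale A (\<theta> i)"
abbreviation Vs where "Vs i \<equiv> eigenspace scale As (\<theta>s i)"

text \<open>The flags are indexed so that the boundary cases need no convention: \<open>F n\<close> is the sum of
  the first \<open>n\<close> dual eigenspaces, with \<open>F 0\<close> zero, and \<open>G n\<close> is zero for \<open>n > d\<close>.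
  The \<open>U i\<close> form the split decomposition.\<close>

definition G :: "nat \<Rightarrow> 'v set" where "G n = span (\<Union>j\<in>{n..d}. V j)"
definition F :: "nat \<Rightarrow> 'v set" where "F n = span (\<Union>j\<in>{j. j < n \<and> j \<le> d}. Vs j)"
definition U :: "nat \<Rightarrow> 'v set" where "U i = F (Suc i) \<inter> G i"

lemma subspace_flags: "subspace (F n)" "subspace (G n)" "subspace (U i)"
  by (simp_all add: F_def G_def U_def subspace_inter)

lemma G_mono: "m \<le> n \<Longrightarrow> G n \<subseteq> G m"
  unfolding G_def by (intro span_mono UN_mono) auto

lemma F_mono: "m \<le> n \<Longrightarrow> F m \<subseteq> F n"
  unfolding F_def by (intro span_mono UN_mono) auto

lemma F_0: "F 0 = {0}"
  by (simp add: F_def)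

lemma G_trivial: "d < n \<Longrightarrow> G n = {0}"
  by (simp add: G_def)

lemma G_A:
  assumes "v \<in> G n"
  shows "A v - \<theta> n *s v \<in> G (Suc n)"
proof (rule lin_span_image[OF lin_minus[OF lin_A lin_scale] subspace_flags(2) _ assms[unfolded G_def]])
  fix w assume "w \<in> (\<Union>j\<in>{n..d}. V j)"
  then obtain j where "n \<le> j" "j \<le> d" "w \<in> V j"
    by auto
  then have j: "n \<le> j" "j \<le> d" "A w = \<theta> j *s w" "w \<in> V j"
    by (simp_all add: eigenspace_def)
  show "A w - \<theta> n *s w \<in> G (Suc n)"
  proof (cases "j = n")
    case True
    then show ?thesis using j subspace_0[OF subspace_flags(2)] by simp
  next
    case False
    then have "w \<in> G (Suc n)"
      unfolding G_def using j by (intro span_base) auto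
    then show ?thesis
      unfolding j(3) by (intro subspace_diff subspace_scale subspace_flags)
  qed
qed

lemma F_As:
  assumes "v \<in> F (Suc n)"
  shows "As v - \<theta>s n *s v \<in> F n"
proof (rule lin_span_image[OF lin_minus[OF lin_As lin_scale] subspace_flags(1) _ assms[unfolded F_def]])
  fix w assume "w \<in> (\<Union>j\<in>{j. j < Suc n \<and> j \<le> d}. Vs j)"
  then obtain j where "j \<le> n" "j \<le> d" "w \<in> Vs j"
    by (auto simp: less_Suc_eq_le)
  then have j: "j \<le> n" "j \<le> d" "As w = \<theta>s j *s w" "w \<in> Vs j"
    by (simp_all add: eigenspace_def)
  show "As w - \<theta>s n *s w \<in> F n"
  proof (cases "j = n")
    case True
    then show ?thesis using j subspace_0[OF subspace_flags(1)] by simp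
  next
    case False
    then have "w \<in> F n"
      unfolding F_def using j by (intro span_base UN_I[of j]) auto
    then show ?thesis
      unfolding j(3) by (intro subspace_diff subspace_scale subspace_flags)
  qed
qed

lemma G_As:
  assumes "v \<in> G n"
  shows "As v \<in> G (n - 1)"
proof (rule lin_span_image[OF lin_As subspace_flags(2) _ assms[unfolded G_def]])
  fix w assume "w \<in> (\<Union>j\<in>{n..d}. V j)"
  then obtain j where j: "n \<le> j" "j \<le> d" "w \<in> V j" by auto
  then have "As w \<in> subspace_sum scale {k. k \<le> d \<and> j \<le> k + 1 \<and> k \<le> j + 1} V"
    using tridiagonal(1) unfolding acts_tridiagonally_def by blast
  also have "\<dots> \<subseteq> G (n - 1)"
    unfolding subspace_sum_eq_span G_def using j by (intro span_mono UN_mono) auto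
  finally show "As w \<in> G (n - 1)" .
qed

lemma F_A:
  assumes "v \<in> F n"
  shows "A v \<in> F (Suc n)"
proof (rule lin_span_image[OF lin_A subspace_flags(1) _ assms[unfolded F_def]])
  fix w assume "w \<in> (\<Union>j\<in>{j. j < n \<and> j \<le> d}. Vs j)"
  then obtain j where j: "j < n" "j \<le> d" "w \<in> Vs j" by auto
  then have "A w \<in> subspace_sum scale {k. k \<le> d \<and> j \<le> k + 1 \<and> k \<le> j + 1} Vs"
    using tridiagonal(2) unfolding acts_tridiagonally_def by blast
  also have "\<dots> \<subseteq> F (Suc n)"
    unfolding subspace_sum_eq_span F_def using j by (intro span_mono UN_mono) auto
  finally show "A w \<in> F (Suc n)" .
qed

text \<open>The intersections of the two flags at offset \<open>r\<close> from the diagonal. Shifted by an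
  eigenvalue, \<open>A\<close> moves such an intersection one step up and \<open>As\<close> one step down along the
  same diagonal, so each sum is invariant under both maps. Offset zero gives the whole space, and
  every positive offset gives zero.\<close>

definition diagonal_sum :: "nat \<Rightarrow> 'v set" where
  "diagonal_sum r = span (\<Union>i. F (Suc i) \<inter> G (i + r))"

lemma raise:
  assumes "u \<in> F (Suc i)" "u \<in> G (i + r)"
  shows "A u - \<theta> (i + r) *s u \<in> F (Suc (Suc i)) \<inter> G (Suc i + r)"
  using G_A[OF assms(2)] F_A[OF assms(1)] F_mono[of "Suc i" "Suc (Suc i)"] assms(1)
  by (auto intro!: subspace_diff subspace_scale subspace_flags)

lemma lower:
  assumes "u \<in> F (Suc i)" "u \<in> G (i + r)"
  shows "As u - \<theta>s i *s u \<in> F i \<inter> G (i + r - 1)"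
  using F_As[OF assms(1)] G_As[OF assms(2)] G_mono[of "i + r - 1" "i + r"] assms(2)
  by (auto intro!: subspace_diff subspace_scale subspace_flags)

lemma diagonal_sum_trivial: "diagonal_sum r = {0} \<or> diagonal_sum r = UNIV"
proof (rule irreducible)
  show "subspace (diagonal_sum r)" by (simp add: diagonal_sum_def)
  have gen: "w \<in> diagonal_sum r" if "w \<in> F (Suc i) \<inter> G (i + r)" for w i
    unfolding diagonal_sum_def using that by (intro span_base) blast
  show "A ` diagonal_sum r \<subseteq> diagonal_sum r"
  proof (rule image_subsetI)
    fix v assume v: "v \<in> diagonal_sum r"
    show "A v \<in> diagonal_sum r"
    proof (rule lin_span_image[OF lin_A _ _ v[unfolded diagonal_sum_def]])
      fix u assume "u \<in> (\<Union>i. F (Suc i) \<inter> G (i + r))"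
      then obtain i where i: "u \<in> F (Suc i)" "u \<in> G (i + r)" by blast
      have "(A u - \<theta> (i + r) *s u) + \<theta> (i + r) *s u \<in> diagonal_sum r"
        using gen[OF raise[OF i]] gen[of u i] i by (intro subspace_add subspace_scale) (auto simp: diagonal_sum_def)
      then show "A u \<in> diagonal_sum r" by simp
    qed (simp add: diagonal_sum_def)
  qed
  show "As ` diagonal_sum r \<subseteq> diagonal_sum r"
  proof (rule image_subsetI)
    fix v assume v: "v \<in> diagonal_sum r"
    show "As v \<in> diagonal_sum r"
    proof (rule lin_span_image[OF lin_As _ _ v[unfolded diagonal_sum_def]])
      fix u assume "u \<in> (\<Union>i. F (Suc i) \<inter> G (i + r))"
      then obtain i where i: "u \<in> F (Suc i)" "u \<in> G (i + r)" by blast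
      have "As u - \<theta>s i *s u \<in> diagonal_sum r"
      proof (cases i)
        case 0
        then show ?thesis using lower[OF i] by (simp add: F_0 diagonal_sum_def span_zero)
      next
        case (Suc j)
        then show ?thesis using lower[OF i] by (intro gen[of _ j]) simp
      qed
      then have "(As u - \<theta>s i *s u) + \<theta>s i *s u \<in> diagonal_sum r"
        using gen[of u i] i by (intro subspace_add subspace_scale) (auto simp: diagonal_sum_def)
      then show "As u \<in> diagonal_sum r" by simp
    qed (simp add: diagonal_sum_def)
  qed
qed

text \<open>For positive offset the invariant sum lies in \<open>G 1\<close>, which misses the eigenspace
  \<open>V 0\<close>.\<close>

lemma above_diagonal:
  assumes "v \<in> F (Suc i)" "v \<in> G (i + r)" "0 < r"
  shows "v = 0"
proof -
  have "diagonal_sum r \<subseteq> G 1"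
    unfolding diagonal_sum_def using assms(3)
    by (intro span_minimal subspace_flags UN_least le_infI2 G_mono) simp
  moreover have "G 1 \<noteq> UNIV"
  proof
    assume G1: "G 1 = UNIV"
    obtain w where w: "w \<noteq> 0" "A w = \<theta> 0 *s w"
      using eigenvalues(1)[of 0] by (auto simp: is_eigenvalue_def)
    have "\<theta> 0 \<noteq> \<theta> j" if "j \<in> {1..d}" for j
      using that inj_onD[OF inj(1), of 0 j] by auto
    then have "\<theta> 0 \<notin> \<theta> ` {1..d}" by blast
    then have "w = 0"
      using eigenspace_disjoint_sum[OF lin_A, of "{1..d}" w \<theta> "\<theta> 0"] w(2) G1 by (simp add: G_def)
    with w show False by simp
  qed
  ultimately have "diagonal_sum r = {0}"
    using diagonal_sum_trivial[of r] by blast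
  moreover have "v \<in> diagonal_sum r"
    unfolding diagonal_sum_def using assms by (intro span_base) blast
  ultimately show ?thesis by simp
qed

lemma split_decomposition: "decomposition d U"
  unfolding decomposition_def
proof (intro conjI allI impI)
  show "subspace (U i)" for i by (rule subspace_flags)
  have "G 0 = UNIV"
    using spans(1) by (simp add: G_def atMost_atLeast0)
  obtain w where w: "w \<noteq> 0" "w \<in> Vs 0"
    using eigenvalues(2)[of 0] by (auto simp: is_eigenvalue_def eigenspace_def)
  have "w \<in> F (Suc 0)"
    unfolding F_def using w by (intro span_base) auto
  then have "w \<in> diagonal_sum 0"
    unfolding diagonal_sum_def using \<open>G 0 = UNIV\<close> by (intro span_base UN_I[of 0]) auto
  then have "diagonal_sum 0 = UNIV"
    using diagonal_sum_trivial[of 0] w(1) by auto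
  moreover have "diagonal_sum 0 \<subseteq> span (\<Union>i\<in>{..d}. U i)"
    unfolding diagonal_sum_def
  proof (intro span_minimal subspace_span UN_least)
    fix i
    show "F (Suc i) \<inter> G (i + 0) \<subseteq> span (\<Union>i\<in>{..d}. U i)"
    proof (cases "i \<le> d")
      case True
      then show ?thesis using span_superset[of "\<Union>i\<in>{..d}. U i"] by (auto simp: U_def)
    next
      case False
      then show ?thesis using G_trivial[of i] by (auto simp: span_zero)
    qed
  qed
  ultimately show "span (\<Union>i\<in>{..d}. U i) = UNIV" by auto
  show "span (\<Union>j\<in>{..<i}. U j) \<inter> U i \<subseteq> {0}" for i
  proof
    fix v assume v: "v \<in> span (\<Union>j\<in>{..<i}. U j) \<inter> U i"
    have "(\<Union>j\<in>{..<i}. U j) \<subseteq> F i"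
      using F_mono[of "Suc _" i] by (auto simp: U_def Suc_le_eq)
    then have vF: "v \<in> F i" using v span_minimal[OF _ subspace_flags(1)] by blast
    show "v \<in> {0}"
    proof (cases i)
      case 0
      then show ?thesis using vF by (simp add: F_0)
    next
      case (Suc k)
      then show ?thesis using vF v above_diagonal[of v k 1] by (simp add: U_def)
    qed
  qed
qed

text \<open>The top component of a vector of \<open>F n\<close> beyond the \<open>n\<close>-th summand lies above the
  diagonal, hence vanishes. As \<open>F n\<close> does not depend on the ordering of the eigenspaces of
  \<open>A\<close>, this is what makes the split maps for both orderings triangular on one flag.\<close>

lemma F_eq_split_sum:
  assumes "n \<le> Suc d"
  shows "F n = span (\<Union>j\<in>{..<n}. U j)"
proof
  show "span (\<Union>j\<in>{..<n}. U j) \<subseteq> F n"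
    using F_mono[of "Suc _" n] by (intro span_minimal subspace_flags) (auto simp: U_def Suc_le_eq)
  have "v \<in> span (\<Union>j\<in>{..<n}. U j)" if "v \<in> F n" "v \<in> span (\<Union>j\<in>{..<n + k}. U j)" for v k
    using that
  proof (induction k arbitrary: v)
    case 0
    then show ?case by simp
  next
    case (Suc k)
    have "(\<Union>j\<in>{..<n + Suc k}. U j) = U (n + k) \<union> (\<Union>j\<in>{..<n + k}. U j)"
      by (auto simp: less_Suc_eq)
    then have "v \<in> span (U (n + k) \<union> (\<Union>j\<in>{..<n + k}. U j))" using Suc.prems(2) by simp
    then obtain u w where uw: "v = u + w" "u \<in> span (U (n + k))" "w \<in> span (\<Union>j\<in>{..<n + k}. U j)"
      unfolding span_Un by blast
    have "u \<in> U (n + k)" using uw(2) subspace_flags(3) span_eq_iff by blast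
    have "(\<Union>j\<in>{..<n + k}. U j) \<subseteq> F (n + k)"
      using F_mono[of "Suc _" "n + k"] by (auto simp: U_def Suc_le_eq)
    then have "w \<in> F (n + k)" using uw(3) span_minimal[OF _ subspace_flags(1)] by blast
    moreover have "v \<in> F (n + k)" using Suc.prems(1) F_mono[of n "n + k"] by auto
    ultimately have "v - w \<in> F (n + k)" by (intro subspace_diff subspace_flags)
    then have uF: "u \<in> F (n + k)" using uw(1) by simp
    have "u = 0"
    proof (cases "n + k")
      case 0
      then show ?thesis using uF by (simp add: F_0)
    next
      case (Suc m)
      then show ?thesis using uF \<open>u \<in> U (n + k)\<close> above_diagonal[of u m 1] by (simp add: U_def)
    qed
    then show ?case using Suc.IH[of w] Suc.prems uw by simp
  qed
  from this[of _ "Suc d - n"] show "F n \<subseteq> span (\<Union>j\<in>{..<n}. U j)"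
    using assms decomposition_spans[OF split_decomposition] by (auto simp: lessThan_Suc_atMost)
qed

lemma raise_split:
  assumes "i \<le> d" "u \<in> U i"
  obtains r where "A u = \<theta> i *s u + r" "r \<in> U (Suc i)" "i = d \<Longrightarrow> r = 0"
proof (rule that)
  show *: "A u - \<theta> i *s u \<in> U (Suc i)"
    using raise[of u i 0] assms(2) by (simp add: U_def)
  show "i = d \<Longrightarrow> A u - \<theta> i *s u = 0"
    using * G_trivial[of "Suc i"] by (simp add: U_def)
qed simp

lemma lower_split:
  assumes "i \<le> d" "u \<in> U i"
  obtains l where "As u = \<theta>s i *s u + l" "i = 0 \<and> l = 0 \<or> 0 < i \<and> l \<in> U (i - 1)"
proof (rule that)
  have *: "As u - \<theta>s i *s u \<in> F i \<inter> G (i - 1)"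
    using lower[of u i 0] assms(2) by (simp add: U_def)
  show "i = 0 \<and> As u - \<theta>s i *s u = 0 \<or> 0 < i \<and> As u - \<theta>s i *s u \<in> U (i - 1)"
    using * by (cases i) (simp_all add: F_0 U_def)
qed simp

text \<open>These are the inverses of \<open>K\<close> and of its three variants, depending on the orderings.\<close>

definition split_map :: "'f \<Rightarrow> ('v \<Rightarrow> 'v) \<Rightarrow> bool" where
  "split_map q X \<longleftrightarrow> lin X \<and> (\<forall>i\<le>d. \<forall>u\<in>U i. X u = q powi (2 * int i - int d) *s u)"

lemma split_mapD: "split_map q X \<Longrightarrow> i \<le> d \<Longrightarrow> u \<in> U i \<Longrightarrow> X u = q powi (2 * int i - int d) *s u"
  by (simp add: split_map_def)

lemma lin_split_map: "split_map q X \<Longrightarrow> lin X"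
  by (simp add: split_map_def)

lemma corresponding_map_split:
  assumes q: "q \<noteq> 0"
    and K: "K = corresponding_map scale q d (\<lambda>i. subspace_sum scale {0..i} Vs \<inter> subspace_sum scale {i..d} V)"
  shows "split_map q (map_inv K)" "bij (map_inv K)"
proof -
  let ?W = "\<lambda>i. subspace_sum scale {0..i} Vs \<inter> subspace_sum scale {i..d} V"
  have eq: "?W i = U i" if "i \<le> d" for i
  proof -
    have "{j. j < Suc i \<and> j \<le> d} = {0..i}" using that by auto
    then show ?thesis by (simp add: subspace_sum_eq_span U_def F_def G_def)
  qed
  have dec: "decomposition d ?W"
    unfolding decomposition_def
  proof (intro conjI allI impI)
    show "subspace (?W i)" if "i \<le> d" for i
      unfolding eq[OF that] by (rule subspace_flags)
    have "(\<Union>i\<in>{..d}. ?W i) = (\<Union>i\<in>{..d}. U i)"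
      using eq by (intro SUP_cong) simp_all
    then show "span (\<Union>i\<in>{..d}. ?W i) = UNIV"
      using decomposition_spans[OF split_decomposition] by (simp only:)
    show "span (\<Union>j\<in>{..<i}. ?W j) \<inter> ?W i \<subseteq> {0}" if i: "i \<le> d" for i
    proof -
      have "(\<Union>j\<in>{..<i}. ?W j) = (\<Union>j\<in>{..<i}. U j)"
        using eq i by (intro SUP_cong) simp_all
      then show ?thesis
        using decomposition_disjoint[OF split_decomposition i] eq[OF i] by (metis (no_types, lifting) IntE singletonI subsetI)
    qed
  qed
  show "split_map q (map_inv K)" "bij (map_inv K)"
    using corresponding_map_properties[OF dec q K] eq by (simp_all add: split_map_def)
qed

text \<open>On \<open>U i\<close> the map \<open>X\<close> is a scalar \<open>x\<close>, and \<open>A\<close> is \<open>a / x + x / a\<close> plus a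
  raising map, whose image \<open>X\<close> multiplies by \<open>q\<^sup>2 x\<close>; in the \<open>q\<close>-commutator the raising
  part cancels.\<close>

lemma split_map_A_relation:
  assumes X: "split_map q X" and q: "q \<noteq> 0" and a: "a \<noteq> 0"
    and theta: "\<And>i. i \<le> d \<Longrightarrow> \<theta> i = a * q powi (int d - 2 * int i) + inverse a * q powi (2 * int i - int d)"
  shows "q *s A (X v) - inverse q *s X (A v) = (q - inverse q) *s (a *s v + inverse a *s X (X v))"
proof (rule lin_eq_on_span[where f = "\<lambda>v. q *s A (X v) - inverse q *s X (A v)"
      and g = "\<lambda>v. (q - inverse q) *s (a *s v + inverse a *s X (X v))"])
  note lX = lin_split_map[OF X]
  show "lin (\<lambda>v. q *s A (X v) - inverse q *s X (A v))"
    "lin (\<lambda>v. (q - inverse q) *s (a *s v + inverse a *s X (X v)))"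
    using lX lin_A by (auto intro!: linI simp: lin_simps scale_right_distrib scale_right_diff_distrib mult.commute algebra_simps)
  show "v \<in> span (\<Union>i\<in>{..d}. U i)"
    by (simp add: decomposition_spans[OF split_decomposition])
  fix u assume "u \<in> (\<Union>i\<in>{..d}. U i)"
  then obtain i where i: "i \<le> d" "u \<in> U i" by blast
  define x where "x = q powi (2 * int i - int d)"
  have x: "x \<noteq> 0" using q by (simp add: x_def power_int_not_zero)
  have "q powi (int d - 2 * int i) = inverse x"
    unfolding x_def using power_int_minus[of q "2 * int i - int d"] by simp
  then have th: "\<theta> i = a * inverse x + inverse a * x"
    using theta[OF i(1)] by (simp add: x_def)
  obtain r where r: "A u = \<theta> i *s u + r" "r \<in> U (Suc i)" "i = d \<Longrightarrow> r = 0"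
    by (rule raise_split[OF i]) (rule that)
  have Xr: "X r = (q * q * x) *s r"
  proof (cases "i = d")
    case True
    then show ?thesis using r(3) lin_simps(3)[OF lX] by simp
  next
    case False
    have "2 * int (Suc i) - int d = (2 * int i - int d) + 2" by simp
    then have "q powi (2 * int (Suc i) - int d) = q * q * x"
      by (simp only: x_def powi_add_2[OF q])
    then show ?thesis using split_mapD[OF X _ r(2)] False i(1) by simp
  qed
  have Xu: "X u = x *s u" using split_mapD[OF X i] by (simp add: x_def)
  have "q *s A (X u) - inverse q *s X (A u) = ((q - inverse q) * (\<theta> i * x)) *s u"
    using q by (simp add: Xu Xr r(1) lin_simps[OF lX] lin_simps[OF lin_A] scale_right_distrib scale_left_diff_distrib algebra_simps)
  also have "\<theta> i * x = a + inverse a * (x * x)"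
    using x by (simp add: th distrib_right)
  finally show "q *s A (X u) - inverse q *s X (A u) = (q - inverse q) *s (a *s u + inverse a *s X (X u))"
    by (simp add: Xu lin_simps[OF lX] scale_right_distrib scale_left_distrib distrib_left)
qed

text \<open>The same computation with a lowering map; the \<open>q\<close>-commutator has the two factors in the
  opposite order.\<close>

lemma split_map_As_relation:
  assumes X: "split_map q X" and q: "q \<noteq> 0"
    and theta: "\<And>i. i \<le> d \<Longrightarrow> \<theta>s i = b * q powi (int d - 2 * int i) + c * q powi (2 * int i - int d)"
  shows "q *s X (As v) - inverse q *s As (X v) = (q - inverse q) *s (b *s v + c *s X (X v))"
proof (rule lin_eq_on_span[where f = "\<lambda>v. q *s X (As v) - inverse q *s As (X v)"
      and g = "\<lambda>v. (q - inverse q) *s (b *s v + c *s X (X v))"])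
  note lX = lin_split_map[OF X]
  show "lin (\<lambda>v. q *s X (As v) - inverse q *s As (X v))"
    "lin (\<lambda>v. (q - inverse q) *s (b *s v + c *s X (X v)))"
    using lX lin_As by (auto intro!: linI simp: lin_simps scale_right_distrib scale_right_diff_distrib mult.commute algebra_simps)
  show "v \<in> span (\<Union>i\<in>{..d}. U i)"
    by (simp add: decomposition_spans[OF split_decomposition])
  fix u assume "u \<in> (\<Union>i\<in>{..d}. U i)"
  then obtain i where i: "i \<le> d" "u \<in> U i" by blast
  define x where "x = q powi (2 * int i - int d)"
  have x: "x \<noteq> 0" using q by (simp add: x_def power_int_not_zero)
  have "q powi (int d - 2 * int i) = inverse x"
    unfolding x_def using power_int_minus[of q "2 * int i - int d"] by simp
  then have th: "\<theta>s i = b * inverse x + c * x"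
    using theta[OF i(1)] by (simp add: x_def)
  obtain l where l: "As u = \<theta>s i *s u + l" "i = 0 \<and> l = 0 \<or> 0 < i \<and> l \<in> U (i - 1)"
    by (rule lower_split[OF i]) (rule that)
  have Xl: "(q * q) *s X l = x *s l"
  proof (cases i)
    case 0
    then show ?thesis using l(2) lin_simps(3)[OF lX] by simp
  next
    case (Suc k)
    have "2 * int i - int d = (2 * int k - int d) + 2" using Suc by simp
    then have "x = q * q * q powi (2 * int k - int d)"
      by (simp only: x_def powi_add_2[OF q])
    then show ?thesis using split_mapD[OF X, of k l] l(2) Suc i(1) by (simp add: mult.assoc)
  qed
  then have "inverse q *s ((q * q) *s X l) = inverse q *s (x *s l)" by simp
  then have Xl': "q *s X l = (inverse q * x) *s l" using q by (simp flip: mult.assoc)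
  have Xu: "X u = x *s u" using split_mapD[OF X i] by (simp add: x_def)
  have "q *s X (As u) - inverse q *s As (X u) = ((q - inverse q) * (\<theta>s i * x)) *s u"
    by (simp add: Xu Xl' l(1) lin_simps[OF lX] lin_simps[OF lin_As] scale_right_distrib scale_left_diff_distrib algebra_simps)
  also have "\<theta>s i * x = b + c * (x * x)"
    using x by (simp add: th distrib_right)
  finally show "q *s X (As u) - inverse q *s As (X u) = (q - inverse q) *s (b *s u + c *s X (X u))"
    by (simp add: Xu lin_simps[OF lX] scale_right_distrib scale_left_distrib distrib_left)
qed

lemma split_map_triangular:
  assumes X: "split_map q X" and i: "i \<le> d" and v: "v \<in> F (Suc i)"
  shows "X v - q powi (2 * int i - int d) *s v \<in> F i"
proof -
  have "v \<in> span (\<Union>j\<in>{..<Suc i}. U j)"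
    using v F_eq_split_sum[of "Suc i"] i by simp
  then show ?thesis
  proof (rule lin_span_image[OF lin_minus[OF lin_split_map[OF X] lin_scale] subspace_flags(1), rotated])
    fix u assume "u \<in> (\<Union>j\<in>{..<Suc i}. U j)"
    then obtain j where j: "j \<le> i" "u \<in> U j" by (auto simp: less_Suc_eq_le)
    then have Xu: "X u = q powi (2 * int j - int d) *s u"
      using i by (intro split_mapD[OF X]) auto
    show "X u - q powi (2 * int i - int d) *s u \<in> F i"
    proof (cases "j = i")
      case True
      then show ?thesis using Xu subspace_0[OF subspace_flags(1)] by simp
    next
      case False
      then have "u \<in> F i" using j F_mono[of "Suc j" i] by (auto simp: U_def)
      then show ?thesis unfolding Xu by (intro subspace_diff subspace_scale subspace_flags)
    qed
  qed
qed

lemma triangular_on_F_bij: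
  assumes M: "lin M" and c: "\<And>i. i \<le> d \<Longrightarrow> c i \<noteq> 0"
    and tri: "\<And>i v. i \<le> d \<Longrightarrow> v \<in> F (Suc i) \<Longrightarrow> M v - c i *s v \<in> F i"
  shows "bij M"
proof (rule triangular_bij[OF M decomposition_spans[OF split_decomposition] _ _ c])
  fix i w assume "i \<le> d" "w \<in> U i"
  then show "M w - c i *s w \<in> span (\<Union>j\<in>{..<i}. U j)"
    using tri[of i w] F_eq_split_sum[of i] by (simp add: U_def)
qed (rule subspace_flags)

text \<open>The linear combination is chosen so that the diagonal entry on \<open>U i\<close>, where
  \<open>X\<close> is a scalar \<open>x\<close>, is \<open>1 / x\<close>. Off the diagonal there is only the raising part of
  \<open>A\<close>, so the map is upper triangular for the summands in reverse order.\<close>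

lemma split_shift_bij:
  assumes X: "split_map q X" and q: "q \<noteq> 0" and a: "a \<noteq> 0"
    and theta: "\<And>i. i \<le> d \<Longrightarrow> \<theta> i = a * q powi (int d - 2 * int i) + inverse a * q powi (2 * int i - int d)"
  shows "bij (lin_comb2 scale (inverse a) A (- (inverse a ^ 2)) X)"
proof (rule triangular_bij[where W = "\<lambda>i. U (d - i)" and d = d and c = "\<lambda>i. q powi (int d - 2 * int (d - i))"])
  show "lin (lin_comb2 scale (inverse a) A (- (inverse a ^ 2)) X)"
    unfolding lin_comb2_def by (intro lin_combine lin_A lin_split_map[OF X])
  show "span (\<Union>i\<in>{..d}. U (d - i)) = UNIV"
    by (simp add: UN_reverse[where W = U] decomposition_spans[OF split_decomposition])
  fix i u assume i: "i \<le> d" and u: "u \<in> U (d - i)"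
  define k where "k = d - i"
  have k: "k \<le> d" "u \<in> U k" using u by (auto simp: k_def)
  obtain r where r: "A u = \<theta> k *s u + r" "r \<in> U (Suc k)" "k = d \<Longrightarrow> r = 0"
    by (rule raise_split[OF k]) (rule that)
  have "lin_comb2 scale (inverse a) A (- (inverse a ^ 2)) X u - q powi (int d - 2 * int k) *s u
      = (inverse a * \<theta> k - inverse a ^ 2 * q powi (2 * int k - int d) - q powi (int d - 2 * int k)) *s u + inverse a *s r"
    by (simp add: lin_comb2_def r(1) split_mapD[OF X k] scale_right_distrib scale_left_diff_distrib)
  also have "inverse a * \<theta> k - inverse a ^ 2 * q powi (2 * int k - int d) - q powi (int d - 2 * int k) = 0"
    using a by (simp add: theta[OF k(1)] distrib_left power2_eq_square mult.assoc[symmetric])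
  finally have eq: "lin_comb2 scale (inverse a) A (- (inverse a ^ 2)) X u - q powi (int d - 2 * int k) *s u = inverse a *s r"
    by simp
  have "r \<in> span (\<Union>j\<in>{..<i}. U (d - j))"
  proof (cases "k = d")
    case True
    then show ?thesis using r(3) by (simp add: span_zero)
  next
    case False
    then have "i > 0" "Suc k = d - (i - 1)" using i by (auto simp: k_def)
    then show ?thesis using r(2) by (intro span_base UN_I[of "i - 1"]) auto
  qed
  then show "lin_comb2 scale (inverse a) A (- (inverse a ^ 2)) X u - q powi (int d - 2 * int (d - i)) *s u
      \<in> span (\<Union>j\<in>{..<i}. U (d - j))"
    using eq by (simp add: k_def span_scale)
qed (use q in \<open>simp_all add: subspace_flags power_int_not_zero\<close>)

end

section \<open>Equitable triples\<close>

context scalar_space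
begin

lemma lin_map_inv:
  assumes "lin f" "bij f"
  shows "lin (map_inv f)"
proof (rule linI)
  have f: "f (map_inv f v) = v" for v
    using assms(2) by (simp add: bij_is_surj surj_f_inv_f)
  have inj: "x = y" if "f x = f y" for x y
    using assms(2) that by (simp add: bij_def inj_eq)
  show "map_inv f (x + y) = map_inv f x + map_inv f y" for x y
    by (rule inj) (simp add: f lin_simps(1)[OF assms(1)])
  show "map_inv f (c *s x) = c *s map_inv f x" for c x
    by (rule inj) (simp add: f lin_simps(2)[OF assms(1)])
qed

lemma equitable_relI:
  assumes "q \<noteq> inverse q" "\<And>v. q *s X (Y v) - inverse q *s Y (X v) = (q - inverse q) *s v"
  shows "equitable_rel scale q X Y"
  unfolding equitable_rel_def lin_comb2_def
proof
  fix v
  let ?e = "inverse (q - inverse q)"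
  have "?e *s (q *s X (Y v) - inverse q *s Y (X v)) = v"
    using assms by simp
  then show "(q / (q - inverse q)) *s (X \<circ> Y) v + (- inverse q / (q - inverse q)) *s (Y \<circ> X) v = id v"
    by (simp add: scale_right_diff_distrib divide_inverse mult.commute)
qed

lemma equitable_triple_rotate: "equitable_triple scale q X Y Z \<Longrightarrow> equitable_triple scale q Y Z X"
  unfolding equitable_triple_def by blast

text \<open>Multiplying by \<open>N\<close> on both sides turns the two relations that contain the inverse of
  \<open>N\<close> into \<open>q N X - q\<^sup>-\<^sup>1 X N = (q - q\<^sup>-\<^sup>1) N\<^sup>2\<close> and
  \<open>q Z N - q\<^sup>-\<^sup>1 N Z = (q - q\<^sup>-\<^sup>1) N\<^sup>2\<close>. In each of them the difference of the two sides is
  a scalar multiple of the quadratic expression in \<open>X\<close> and \<open>Y\<close>. The relation between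
  \<open>Z\<close> and \<open>X\<close> is the \<open>q\<close>-commutator of \<open>A\<close> and \<open>X\<close>.\<close>

lemma equitable_triple_of_quadratic_relation:
  assumes lin: "lin A" "lin X" "lin Y"
    and q: "q \<noteq> 0" "q \<noteq> inverse q" and a: "a \<noteq> 0" "a\<^sup>2 \<noteq> 1"
    and XA: "\<And>v. q *s A (X v) - inverse q *s X (A v) = (q - inverse q) *s (a *s v + inverse a *s X (X v))"
    and YA: "\<And>v. q *s A (Y v) - inverse q *s Y (A v) = (q - inverse q) *s (inverse a *s v + a *s Y (Y v))"
    and Q: "\<And>v. quadratic (q - inverse q) (a\<^sup>2 * (q - inverse q)) (a\<^sup>2 * q - inverse q) (q - a\<^sup>2 * inverse q) X Y v = 0"
    and N: "N = lin_comb2 scale (inverse a / (inverse a - a)) X (- a / (inverse a - a)) Y"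
    and Z: "Z = lin_comb2 scale (inverse a) A (- (inverse a ^ 2)) X"
    and bij: "bij X" "bij N" "bij Z"
  shows "equitable_triple scale q X (map_inv N) Z"
proof -
  define p r t where "p = inverse q" "r = inverse a" "t = inverse (r - a)"
  have "r - a \<noteq> 0"
    using a unfolding p_r_t_def by (simp add: field_simps power2_eq_square)
  then have units: "a * r = 1" "t * (r - a) = 1" "q * p = 1"
    using a q by (simp_all add: p_r_t_def)
  define m n where "m = r * t" "n = - a * t"
  have Nv: "N v = m *s X v + n *s Y v" for v
    by (simp add: N lin_comb2_def p_r_t_def m_n_def divide_inverse)
  have Zv: "Z v = r *s A v - r\<^sup>2 *s X v" for v
    by (simp add: Z lin_comb2_def p_r_t_def)
  have linN: "lin N"
    unfolding N lin_comb2_def by (rule lin_combine[OF lin(2,3)])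
  have linZ: "lin Z"
    unfolding Z lin_comb2_def by (rule lin_combine[OF lin(1,2)])
  note linear_rules = lin_simps(1,2,5)[OF lin(1)] lin_simps(1,2,5)[OF lin(2)] lin_simps(1,2,5)[OF lin(3)]
    scale_right_distrib scale_right_diff_distrib
  have Q': "(q - p) *s X (X v) + (a\<^sup>2 * (q - p)) *s Y (Y v) - (a\<^sup>2 * q - p) *s Y (X v) - (q - a\<^sup>2 * p) *s X (Y v) = 0" for v
    using Q[of v] by (simp only: quadratic_def p_r_t_def(1))
  have NX: "q *s N (X v) - p *s X (N v) = (q - p) *s N (N v)" for v
  proof -
    have "q *s N (X v) - p *s X (N v) - (q - p) *s N (N v)
        = ((q - p) * (m - m * m)) *s X (X v) + (- (q - p) * n * n) *s Y (Y v)
          - ((q - p) * m * n - q * n) *s Y (X v) - ((q - p) * m * n + p * n) *s X (Y v)"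
      by (simp add: Nv linear_rules algebra_simps)
    also have "(q - p) * (m - m * m) = - t\<^sup>2 * (q - p)"
      unfolding m_n_def using units by Groebner_Basis.algebra
    also have "- (q - p) * n * n = - t\<^sup>2 * (a\<^sup>2 * (q - p))"
      unfolding m_n_def by Groebner_Basis.algebra
    also have "(q - p) * m * n - q * n = - t\<^sup>2 * (a\<^sup>2 * q - p)"
      unfolding m_n_def using units by Groebner_Basis.algebra
    also have "(q - p) * m * n + p * n = - t\<^sup>2 * (q - a\<^sup>2 * p)"
      unfolding m_n_def using units by Groebner_Basis.algebra
    also have "(- t\<^sup>2 * (q - p)) *s X (X v) + (- t\<^sup>2 * (a\<^sup>2 * (q - p))) *s Y (Y v)
        - (- t\<^sup>2 * (a\<^sup>2 * q - p)) *s Y (X v) - (- t\<^sup>2 * (q - a\<^sup>2 * p)) *s X (Y v)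
      = (- t\<^sup>2) *s ((q - p) *s X (X v) + (a\<^sup>2 * (q - p)) *s Y (Y v) - (a\<^sup>2 * q - p) *s Y (X v) - (q - a\<^sup>2 * p) *s X (Y v))"
      by (simp only: scale_scale scale_right_distrib scale_right_diff_distrib)
    finally show ?thesis
      unfolding Q' by simp
  qed
  have ZN: "q *s Z (N v) - p *s N (Z v) = (q - p) *s N (N v)" for v
  proof -
    have "q *s Z (N v) - p *s N (Z v) - (q - p) *s N (N v)
        = (r * m) *s (q *s A (X v) - p *s X (A v)) + (r * n) *s (q *s A (Y v) - p *s Y (A v))
          + ((p - q) * r\<^sup>2 * m - (q - p) * m * m) *s X (X v) + (- (q - p) * n * n) *s Y (Y v)
          - ((q - p) * m * n - p * r\<^sup>2 * n) *s Y (X v) - ((q - p) * m * n + q * r\<^sup>2 * n) *s X (Y v)"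
      by (simp add: Nv Zv linear_rules algebra_simps)
    also have "\<dots> = ((q - p) * (r * m * a + r * n * r)) *s v
          + ((q - p) * r * m * r + (p - q) * r\<^sup>2 * m - (q - p) * m * m) *s X (X v)
          + ((q - p) * r * n * a - (q - p) * n * n) *s Y (Y v)
          - ((q - p) * m * n - p * r\<^sup>2 * n) *s Y (X v) - ((q - p) * m * n + q * r\<^sup>2 * n) *s X (Y v)"
      unfolding XA[folded p_r_t_def(1), folded p_r_t_def(2)] YA[folded p_r_t_def(1), folded p_r_t_def(2)]
      by (simp add: linear_rules algebra_simps)
    also have "(q - p) * (r * m * a + r * n * r) = 0"
      by (simp add: m_n_def mult_ac)
    also have "(q - p) * r * m * r + (p - q) * r\<^sup>2 * m - (q - p) * m * m = (- r\<^sup>2 * t\<^sup>2) * (q - p)"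
      by (simp add: m_n_def power2_eq_square algebra_simps)
    also have "(q - p) * r * n * a - (q - p) * n * n = (- r\<^sup>2 * t\<^sup>2) * (a\<^sup>2 * (q - p))"
      unfolding m_n_def using units by Groebner_Basis.algebra
    also have "(q - p) * m * n - p * r\<^sup>2 * n = (- r\<^sup>2 * t\<^sup>2) * (a\<^sup>2 * q - p)"
      unfolding m_n_def using units by Groebner_Basis.algebra
    also have "(q - p) * m * n + q * r\<^sup>2 * n = (- r\<^sup>2 * t\<^sup>2) * (q - a\<^sup>2 * p)"
      unfolding m_n_def using units by Groebner_Basis.algebra
    also have "0 *s v + ((- r\<^sup>2 * t\<^sup>2) * (q - p)) *s X (X v) + ((- r\<^sup>2 * t\<^sup>2) * (a\<^sup>2 * (q - p))) *s Y (Y v)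
        - ((- r\<^sup>2 * t\<^sup>2) * (a\<^sup>2 * q - p)) *s Y (X v) - ((- r\<^sup>2 * t\<^sup>2) * (q - a\<^sup>2 * p)) *s X (Y v)
      = (- r\<^sup>2 * t\<^sup>2) *s ((q - p) *s X (X v) + (a\<^sup>2 * (q - p)) *s Y (Y v) - (a\<^sup>2 * q - p) *s Y (X v) - (q - a\<^sup>2 * p) *s X (Y v))"
      by (simp only: scale_scale scale_right_distrib scale_right_diff_distrib scale_zero_left add_0_left)
    finally show ?thesis
      unfolding Q' by simp
  qed
  have ZX: "q *s Z (X v) - p *s X (Z v) = (q - p) *s v" for v
  proof -
    have "q *s Z (X v) - p *s X (Z v) = r *s (q *s A (X v) - p *s X (A v)) - ((q - p) * r\<^sup>2) *s X (X v)"
      by (simp add: Zv linear_rules algebra_simps)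
    also have "\<dots> = ((q - p) * (r * a)) *s v"
      unfolding XA[folded p_r_t_def(1), folded p_r_t_def(2)]
      by (simp add: linear_rules power2_eq_square algebra_simps)
    finally show ?thesis
      using units(1) by (simp add: mult.commute)
  qed
  have NN: "N (map_inv N v) = v" "map_inv N (N v) = v" for v
    using bij(2) by (simp_all add: bij_is_surj surj_f_inv_f bij_is_inj)
  have injN: "x = y" if "N x = N y" for x y
    using that NN(2) by metis
  note linN_rules = lin_simps(1,2,5)[OF linN]
  show ?thesis
    unfolding equitable_triple_def invertible_map_def
  proof (intro conjI equitable_relI q(2))
    show "lin X" "lin Z" "lin (map_inv N)" "bij X" "bij Z" "bij (map_inv N)"
      using lin linZ bij lin_map_inv[OF linN bij(2)] by (simp_all add: bij_imp_bij_inv)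
    show "q *s X (map_inv N v) - inverse q *s map_inv N (X v) = (q - inverse q) *s v" for v
      by (rule injN) (use NX[of "map_inv N v"] in \<open>simp add: linN_rules NN p_r_t_def(1)\<close>)
    show "q *s map_inv N (Z v) - inverse q *s Z (map_inv N v) = (q - inverse q) *s v" for v
      by (rule injN) (use ZN[of "map_inv N v"] in \<open>simp add: linN_rules NN p_r_t_def(1)\<close>)
    show "q *s Z (X v) - inverse q *s X (Z v) = (q - inverse q) *s v" for v
      using ZX[of v] by (simp only: p_r_t_def(1))
  qed
qed

end

section \<open>Eigenvalues and the defining relations\<close>

lemma powi_inj:
  fixes q :: "'f::field"
  assumes q: "q \<noteq> 0" "\<And>n::nat. n > 0 \<Longrightarrow> q ^ n \<noteq> 1" and eq: "q powi m = q powi n"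
  shows "m = n"
proof -
  have *: "k \<le> l" if "q powi k = q powi l" for k l :: int
  proof (rule ccontr)
    assume "\<not> k \<le> l"
    then have "q powi k = q powi l * q ^ nat (k - l)"
      using q(1) power_int_add[of q l "k - l"] by (simp add: power_int_def)
    then have "q ^ nat (k - l) = 1"
      using that q(1) by (simp add: power_int_not_zero)
    then show False using q(2)[of "nat (k - l)"] \<open>\<not> k \<le> l\<close> by simp
  qed
  show ?thesis using *[OF eq] *[OF eq[symmetric]] by simp
qed

text \<open>The index is an integer, since the two values just outside \<open>0, \<dots>, d\<close> occur when \<open>A\<^sup>*\<close> is shown
  to be tridiagonal.\<close>

definition askey_wilson :: "'f::field \<Rightarrow> 'f \<Rightarrow> nat \<Rightarrow> int \<Rightarrow> 'f" where
  "askey_wilson q a d k = a * q powi (int d - 2 * k) + inverse a * q powi (2 * k - int d)"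

lemma askey_wilson_diff:
  fixes q :: "'f::field"
  assumes q: "q \<noteq> 0"
  shows "askey_wilson q a d k - askey_wilson q a d l
    = (q powi (int d - 2 * k) - q powi (int d - 2 * l)) * (a - inverse a * q powi (2 * (k + l) - 2 * int d))"
proof -
  have "q powi (2 * (k + l) - 2 * int d) * q powi (int d - 2 * k) = q powi (2 * l - int d)"
    "q powi (2 * (k + l) - 2 * int d) * q powi (int d - 2 * l) = q powi (2 * k - int d)"
    using q by (simp_all add: algebra_simps flip: power_int_add)
  then show ?thesis
    unfolding askey_wilson_def by (simp add: algebra_simps)
qed

text \<open>By the product formula for the difference, a coincidence at distinct indices depends only on the sum
  of the indices. If that sum is also attained by distinct indices in the range \<open>0, \<dots>, d\<close>, then
  two of the values in that range
  coincide, against injectivity.\<close>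

lemma askey_wilson_eq_imp_eq:
  fixes q :: "'f::field"
  assumes q: "q \<noteq> 0" "\<And>n::nat. n > 0 \<Longrightarrow> q ^ n \<noteq> 1"
    and inj: "\<And>i j. i \<le> d \<Longrightarrow> j \<le> d \<Longrightarrow> askey_wilson q a d (int i) = askey_wilson q a d (int j) \<Longrightarrow> i = j"
    and eq: "askey_wilson q a d k = askey_wilson q a d l" and kl: "1 \<le> k + l" "k + l \<le> 2 * int d - 1"
  shows "k = l"
proof (rule ccontr)
  assume "k \<noteq> l"
  then have "q powi (int d - 2 * k) \<noteq> q powi (int d - 2 * l)"
    using powi_inj[of q "int d - 2 * k" "int d - 2 * l", OF q] by auto
  moreover have "(q powi (int d - 2 * k) - q powi (int d - 2 * l)) * (a - inverse a * q powi (2 * (k + l) - 2 * int d)) = 0"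
    using eq by (simp only: askey_wilson_diff[OF q(1), symmetric] diff_self)
  ultimately have z: "a - inverse a * q powi (2 * (k + l) - 2 * int d) = 0"
    by simp
  define i j where "i = (if k + l \<le> int d then 0 else d)" and "j = nat (k + l - int i)"
  have ij: "i \<le> d" "j \<le> d" "i \<noteq> j" "int i + int j = k + l"
    using kl by (auto simp: i_def j_def)
  have "askey_wilson q a d (int i) - askey_wilson q a d (int j) = 0"
    unfolding askey_wilson_diff[OF q(1)] ij(4) z by simp
  then show False using inj[of i j] ij by simp
qed

text \<open>The expression on the left is, for fixed index \<open>i\<close>, a quadratic polynomial in the value at
  \<open>j\<close>, and its roots are the values at \<open>i - 1\<close> and \<open>i + 1\<close>.\<close>

lemma askey_wilson_adjacent:
  fixes q :: "'f::field"
  assumes q: "q \<noteq> 0" "\<And>n::nat. n > 0 \<Longrightarrow> q ^ n \<noteq> 1" and a: "a \<noteq> 0"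
    and inj: "\<And>i j. i \<le> d \<Longrightarrow> j \<le> d \<Longrightarrow> askey_wilson q a d (int i) = askey_wilson q a d (int j) \<Longrightarrow> i = j"
    and ij: "i \<le> d" "j \<le> d"
    and zero: "(inverse q * askey_wilson q a d (int j) - q * askey_wilson q a d (int i))
       * (q * askey_wilson q a d (int j) - inverse q * askey_wilson q a d (int i)) + (q^2 - (inverse q)^2)^2 = 0"
  shows "i \<le> j + 1 \<and> j \<le> i + 1"
proof (rule ccontr)
  assume far: "\<not> (i \<le> j + 1 \<and> j \<le> i + 1)"
  define p x y where "p = inverse q" "x = q powi (int d - 2 * int i)" "y = inverse x"
  define \<theta> where "\<theta> = askey_wilson q a d"
  have units: "q * p = 1" "x * y = 1" "a * inverse a = 1"
    using q a by (simp_all add: p_x_y_def power_int_not_zero)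
  have y: "y = q powi (2 * int i - int d)"
    unfolding p_x_y_def using power_int_minus[of q "int d - 2 * int i"] by simp
  have p2: "q powi (m - 2) = p\<^sup>2 * q powi m" for m
    using q power_int_diff[of q m 2] by (simp add: p_x_y_def divide_inverse power_inverse mult.commute)
  have q2: "q powi (m + 2) = q\<^sup>2 * q powi m" for m
    using q power_int_add[of q m 2] by (simp add: mult.commute)
  have i: "\<theta> (int i) = a * x + inverse a * y"
    by (simp add: \<theta>_def askey_wilson_def y p_x_y_def(2))
  have e1: "int d - 2 * (int i - 1) = (int d - 2 * int i) + 2" "2 * (int i - 1) - int d = (2 * int i - int d) - 2"
    and e2: "int d - 2 * (int i + 1) = (int d - 2 * int i) - 2" "2 * (int i + 1) - int d = (2 * int i - int d) + 2"
    by simp_all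
  have up: "\<theta> (int i - 1) = a * (q\<^sup>2 * x) + inverse a * (p\<^sup>2 * y)"
    and down: "\<theta> (int i + 1) = a * (p\<^sup>2 * x) + inverse a * (q\<^sup>2 * y)"
    unfolding \<theta>_def askey_wilson_def e1 e2 p2 q2 y p_x_y_def(2) by simp_all
  have "(\<theta> (int j) - \<theta> (int i - 1)) * (\<theta> (int j) - \<theta> (int i + 1))
      = (p * \<theta> (int j) - q * \<theta> (int i)) * (q * \<theta> (int j) - p * \<theta> (int i)) + (q\<^sup>2 - p\<^sup>2)\<^sup>2"
    unfolding up down i using units by Groebner_Basis.algebra
  also have "\<dots> = 0"
    using zero by (simp only: \<theta>_def p_x_y_def(1))
  finally consider "\<theta> (int i - 1) = \<theta> (int j)" | "\<theta> (int i + 1) = \<theta> (int j)" by auto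
  then show False
  proof cases
    case 1
    have "int i - 1 = int j"
    proof (rule askey_wilson_eq_imp_eq[where q = q and a = a and d = d])
      show "askey_wilson q a d (int i - 1) = askey_wilson q a d (int j)"
        using 1 by (simp only: \<theta>_def)
      show "1 \<le> int i - 1 + int j" "int i - 1 + int j \<le> 2 * int d - 1"
        using far ij by auto
    qed (rule q inj; assumption)+
    then show ?thesis using far by linarith
  next
    case 2
    have "int i + 1 = int j"
    proof (rule askey_wilson_eq_imp_eq[where q = q and a = a and d = d])
      show "askey_wilson q a d (int i + 1) = askey_wilson q a d (int j)"
        using 2 by (simp only: \<theta>_def)
      show "1 \<le> int i + 1 + int j" "int i + 1 + int j \<le> 2 * int d - 1"
        using far ij by auto
    qed (rule q inj; assumption)+
    then show ?thesis using far by linarith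
  qed
qed

lemma three_term_recurrence_solution:
  fixes q :: "'f::field" and s :: "nat \<Rightarrow> 'f"
  assumes q: "q \<noteq> 0" "q^4 \<noteq> 1"
    and rec: "\<And>i. Suc (Suc i) \<le> d \<Longrightarrow> s (Suc (Suc i)) = (q^2 + (inverse q)^2) * s (Suc i) - s i"
  obtains b c where "\<And>i. i \<le> d \<Longrightarrow> s i = b * q powi (int d - 2 * int i) + c * q powi (2 * int i - int d)"
proof -
  define p where "p = inverse q"
  have qp: "q * p = 1" using q by (simp add: p_def)
  have "q\<^sup>2 \<noteq> p\<^sup>2"
  proof
    assume "q\<^sup>2 = p\<^sup>2"
    then have "q ^ 4 = 1" using qp by Groebner_Basis.algebra
    then show False using q by simp
  qed
  then have e: "(q\<^sup>2 - p\<^sup>2) * inverse (q\<^sup>2 - p\<^sup>2) = 1" by simp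
  define b c where "b = (q\<^sup>2 * s 0 - s 1) * inverse (q\<^sup>2 - p\<^sup>2)" "c = (s 1 - p\<^sup>2 * s 0) * inverse (q\<^sup>2 - p\<^sup>2)"
  have s: "i \<le> d \<longrightarrow> s i = b * (p\<^sup>2) ^ i + c * (q\<^sup>2) ^ i" for i
  proof (induction i rule: less_induct)
    case (less i)
    consider "i = 0" | "i = 1" | k where "i = Suc (Suc k)"
      by (metis One_nat_def not0_implies_Suc)
    then show ?case
    proof cases
      case 1
      have "s 0 = b + c" unfolding b_c_def using e by Groebner_Basis.algebra
      then show ?thesis using 1 by simp
    next
      case 2
      have "s 1 = b * p\<^sup>2 + c * q\<^sup>2" unfolding b_c_def using e by Groebner_Basis.algebra
      then show ?thesis using 2 by simp
    next
      case 3
      show ?thesis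
      proof
        assume i: "i \<le> d"
        define P R where "P = (p\<^sup>2) ^ k" "R = (q\<^sup>2) ^ k"
        have "s k = b * P + c * R" "s (Suc k) = b * (p\<^sup>2 * P) + c * (q\<^sup>2 * R)"
          using less.IH[of k] less.IH[of "Suc k"] 3 i by (simp_all add: P_R_def)
        moreover have "s i = (q\<^sup>2 + p\<^sup>2) * s (Suc k) - s k"
          using rec[of k] 3 i by (simp add: p_def)
        ultimately have "s i = b * (p\<^sup>2 * (p\<^sup>2 * P)) + c * (q\<^sup>2 * (q\<^sup>2 * R))"
          using qp by Groebner_Basis.algebra
        then show "s i = b * (p\<^sup>2) ^ i + c * (q\<^sup>2) ^ i"
          by (simp add: 3 P_R_def)
      qed
    qed
  qed
  show ?thesis
  proof (rule that[of "b * q powi (- int d)" "c * q powi int d"])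
    fix i assume "i \<le> d"
    have "q powi (- int d) * q powi (int d - 2 * int i) = (p\<^sup>2) ^ i"
    proof -
      have "q powi (- int d) * q powi (int d - 2 * int i) = q powi (- int d + (int d - 2 * int i))"
        using q by (intro power_int_add[symmetric]) simp
      also have "- int d + (int d - 2 * int i) = - int (2 * i)" by simp
      finally have "q powi (- int d) * q powi (int d - 2 * int i) = q powi (- int (2 * i))" .
      also have "\<dots> = inverse (q ^ (2 * i))"
        by (simp only: power_int_minus power_int_of_nat)
      finally show ?thesis by (simp add: p_def power_mult power_inverse)
    qed
    moreover have "q powi int d * q powi (2 * int i - int d) = (q\<^sup>2) ^ i"
    proof -
      have "q powi int d * q powi (2 * int i - int d) = q powi (int d + (2 * int i - int d))"
        using q by (intro power_int_add[symmetric]) simp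
      also have "int d + (2 * int i - int d) = int (2 * i)" by simp
      finally have "q powi int d * q powi (2 * int i - int d) = q powi (int (2 * i))" .
      then show ?thesis by (simp only: power_int_of_nat power_mult)
    qed
    ultimately show "s i = b * q powi (- int d) * q powi (int d - 2 * int i) + c * q powi int d * q powi (2 * int i - int d)"
      using s[of i] \<open>i \<le> d\<close> by (simp add: mult.assoc)
  qed
qed

context scalar_space
begin

text \<open>The defining relation of the \<open>q\<close>-Onsager algebra as a property of two maps, with \<open>M\<close> and
  \<open>M'\<close> the inner two of the three nested commutators.\<close>

definition dolan_grady :: "'f \<Rightarrow> ('v \<Rightarrow> 'v) \<Rightarrow> ('v \<Rightarrow> 'v) \<Rightarrow> bool" where
  "dolan_grady q S T \<longleftrightarrow> (\<forall>v.
     let M = (\<lambda>v. q *s S (T v) - inverse q *s T (S v));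
         M' = (\<lambda>v. inverse q *s S (M v) - q *s M (S v))
     in S (M' v) - M' (S v) = ((q^2 - (inverse q)^2)^2) *s (T (S v) - S (T v)))"

text \<open>On an eigenvector \<open>v\<close> of \<open>S\<close> the relation says that a cubic polynomial in
  \<open>S\<close> kills \<open>T v\<close>. On the component in an eigenspace of \<open>S\<close> this
  polynomial acts as a scalar.\<close>

lemma dolan_grady_components:
  assumes lin: "lin S" "lin T" and rel: "dolan_grady q S T" and dec: "decomposition d (\<lambda>i. eigenspace scale S (t i))"
    and P: "projections d (\<lambda>i. eigenspace scale S (t i)) P"
    and v: "S v = c *s v" and j: "j \<le> d"
  shows "((t j - c) * ((inverse q * t j - q * c) * (q * t j - inverse q * c) + (q^2 - (inverse q)^2)^2)) *s P j (T v) = 0"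
proof -
  note p = projectionsD[OF P]
  define r e where "r = inverse q" "e = (q^2 - (inverse q)^2)^2"
  have PS: "P j (S u) = t j *s P j u" for u
  proof (rule lin_eq_on_span[where f = "\<lambda>u. P j (S u)" and g = "\<lambda>u. t j *s P j u"])
    show "lin (\<lambda>u. P j (S u))" by (rule lin_compose[OF p(3)[OF j] lin(1)])
    show "lin (\<lambda>u. t j *s P j u)" by (rule lin_compose[OF lin_scale p(3)[OF j]])
    show "u \<in> span (\<Union>i\<in>{..d}. eigenspace scale S (t i))"
      by (simp add: decomposition_spans[OF dec])
    fix w assume "w \<in> (\<Union>i\<in>{..d}. eigenspace scale S (t i))"
    then obtain i where i: "i \<le> d" "w \<in> eigenspace scale S (t i)" by auto
    then have Sw: "S w = t i *s w" by (simp add: eigenspace_def)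
    show "P j (S w) = t j *s P j w"
      using i j by (simp add: Sw lin_simps[OF p(3)[OF j]] p(4)[OF i(1) j i(2)])
  qed
  note linear_rules = lin_simps(1,2,5)[OF lin(1)] lin_simps(1,2,5)[OF lin(2)] lin_simps(1,2,5)[OF p(3)[OF j]]
  have "P j (S (r *s S (q *s S (T v) - r *s T (S v)) - q *s (q *s S (T (S v)) - r *s T (S (S v))))
      - (r *s S (q *s S (T (S v)) - r *s T (S (S v))) - q *s (q *s S (T (S (S v))) - r *s T (S (S (S v))))))
    = P j (e *s (T (S v) - S (T v)))"
    using rel[unfolded dolan_grady_def Let_def, rule_format, of v] by (simp only: r_e_def)
  then have "P j (S (r *s S (q *s S (T v) - r *s T (S v)) - q *s (q *s S (T (S v)) - r *s T (S (S v))))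
      - (r *s S (q *s S (T (S v)) - r *s T (S (S v))) - q *s (q *s S (T (S (S v))) - r *s T (S (S (S v))))))
    - P j (e *s (T (S v) - S (T v))) = 0" by simp
  then have "((t j - c) * ((r * t j - q * c) * (q * t j - r * c) + e)) *s P j (T v) = 0"
    by (simp add: v linear_rules PS scale_right_diff_distrib scale_right_distrib algebra_simps)
  then show ?thesis by (simp only: r_e_def)
qed

lemma dolan_grady_tridiagonal:
  assumes lin: "lin S" "lin T" and rel: "dolan_grady q S T" and dec: "decomposition d (\<lambda>i. eigenspace scale S (t i))"
    and adj: "\<And>i j. i \<le> d \<Longrightarrow> j \<le> d \<Longrightarrow> t j = t i \<or>
      (inverse q * t j - q * t i) * (q * t j - inverse q * t i) + (q^2 - (inverse q)^2)^2 = 0 \<Longrightarrow> i \<le> j + 1 \<and> j \<le> i + 1"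
  shows "acts_tridiagonally scale d T (\<lambda>i. eigenspace scale S (t i))"
  unfolding acts_tridiagonally_def
proof (intro allI impI image_subsetI)
  fix i v assume i: "i \<le> d" and v: "v \<in> eigenspace scale S (t i)"
  obtain P where proj: "projections d (\<lambda>i. eigenspace scale S (t i)) P"
    by (rule decomposition_projections[OF dec])
  note P = projectionsD[OF proj]
  let ?S = "subspace_sum scale {j. j \<le> d \<and> i \<le> j + 1 \<and> j \<le> i + 1} (\<lambda>i. eigenspace scale S (t i))"
  have "P j (T v) \<in> ?S" if j: "j \<le> d" for j
  proof (cases "i \<le> j + 1 \<and> j \<le> i + 1")
    case True
    then show ?thesis
      unfolding subspace_sum_eq_span using P(1)[OF j, of "T v"] j by (intro span_base) blast
  next
    case False
    have "S v = t i *s v" using v by (simp add: eigenspace_def)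
    from dolan_grady_components[OF lin rel dec proj this j]
    have "t j = t i \<or> (inverse q * t j - q * t i) * (q * t j - inverse q * t i) + (q^2 - (inverse q)^2)^2 = 0 \<or> P j (T v) = 0"
      by simp
    then have "P j (T v) = 0"
      using adj[OF i j] False by blast
    then show ?thesis by (simp add: subspace_sum_eq_span span_zero)
  qed
  then have "(\<Sum>j\<le>d. P j (T v)) \<in> ?S"
    unfolding subspace_sum_eq_span by (intro span_sum) simp
  then show "T v \<in> ?S" by (simp only: P(2))
qed

end

context tridiagonal_pair
begin

lemma dual_decomposition: "decomposition d Vs"
  unfolding decomposition_def
proof (intro conjI allI impI)
  show "subspace (Vs i)" for i by (rule subspace_eigenspace[OF lin_As])
  show "span (\<Union>i\<in>{..d}. Vs i) = UNIV" by (rule spans(2))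
  show "span (\<Union>j\<in>{..<i}. Vs j) \<inter> Vs i \<subseteq> {0}" if i: "i \<le> d" for i
  proof
    fix v assume v: "v \<in> span (\<Union>j\<in>{..<i}. Vs j) \<inter> Vs i"
    have "\<theta>s i \<noteq> \<theta>s j" if "j < i" for j
      using that i inj_onD[OF inj(2), of i j] by auto
    then have "\<theta>s i \<notin> \<theta>s ` {..<i}" by auto
    then have "v = 0"
      using v by (intro eigenspace_disjoint_sum[OF lin_As, of "{..<i}" v \<theta>s "\<theta>s i"]) (auto simp: eigenspace_def)
    then show "v \<in> {0}" by simp
  qed
qed

text \<open>If the left-hand side were nonzero, the image under \<open>A\<close> of the \<open>i\<close>-th dual eigenspace would
  have no component in the next one, and the sum of the first dual eigenspaces up to the
  \<open>i\<close>-th would be a proper invariant subspace.\<close>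

lemma dual_eigenvalues_adjacent:
  assumes rel: "dolan_grady q As A" and i: "Suc i \<le> d"
  shows "(inverse q * \<theta>s (Suc i) - q * \<theta>s i) * (q * \<theta>s (Suc i) - inverse q * \<theta>s i) + (q^2 - (inverse q)^2)^2 = 0"
proof (rule ccontr)
  assume nz: "\<not> ?thesis"
  obtain P where proj: "projections d Vs P"
    by (rule decomposition_projections[OF dual_decomposition])
  note P = projectionsD[OF proj]
  let ?S = "span (\<Union>j\<in>{..<Suc i}. Vs j)"
  have base: "w \<in> ?S" if "w \<in> Vs j" "j \<le> i" for w j
    using that by (intro span_base UN_I[of j]) auto
  have A: "A w \<in> ?S" if w: "w \<in> Vs j" and j: "j \<le> i" for w j
  proof -
    let ?N = "{k. k \<le> d \<and> j \<le> k + 1 \<and> k \<le> j + 1}"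
    have Aw: "A w \<in> span (\<Union>k\<in>?N. Vs k)"
      using tridiagonal(2)[unfolded acts_tridiagonally_def, rule_format, of j] w j i by (auto simp: subspace_sum_eq_span)
    have "P k (A w) \<in> ?S" if k: "k \<le> d" for k
    proof (cases "k \<le> i")
      case True
      then show ?thesis using base P(1)[OF k] by blast
    next
      case False
      have "P k (A w) = 0"
      proof (cases "k = Suc i \<and> j = i")
        case True
        have "As w = \<theta>s i *s w" using w True by (simp add: eigenspace_def)
        from dolan_grady_components[OF lin_As lin_A rel dual_decomposition proj this k]
        have "\<theta>s (Suc i) = \<theta>s i \<or> P k (A w) = 0" using nz True by simp
        then show ?thesis using inj_onD[OF inj(2), of "Suc i" i] i by auto
      next
        case F: False
        have "P k (A w) \<in> {0}"
        proof (rule lin_span_image[OF P(3)[OF k] subspace_single_0 _ Aw])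
          fix u assume "u \<in> (\<Union>k\<in>?N. Vs k)"
          then obtain l where l: "l \<le> d" "l \<le> j + 1" "u \<in> Vs l" by auto
          then have "k \<noteq> l" using F False j by auto
          then show "P k u \<in> {0}" using P(4)[OF l(1) k l(3)] by simp
        qed
        then show ?thesis by simp
      qed
      then show ?thesis by (simp add: span_zero)
    qed
    then have "(\<Sum>k\<le>d. P k (A w)) \<in> ?S" by (intro span_sum) simp
    then show ?thesis by (simp only: P(2))
  qed
  have "?S = {0} \<or> ?S = UNIV"
  proof (rule irreducible)
    show "A ` ?S \<subseteq> ?S"
    proof (rule image_subsetI)
      fix v assume "v \<in> ?S"
      then show "A v \<in> ?S"
        by (rule lin_span_image[OF lin_A subspace_span, rotated]) (auto simp: less_Suc_eq_le intro: A)
    qed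
    show "As ` ?S \<subseteq> ?S"
    proof (rule image_subsetI)
      fix v assume v: "v \<in> ?S"
      show "As v \<in> ?S"
      proof (rule lin_span_image[OF lin_As subspace_span _ v])
        fix w assume "w \<in> (\<Union>j\<in>{..<Suc i}. Vs j)"
        then obtain j where j: "j \<le> i" "w \<in> Vs j" by (auto simp: less_Suc_eq_le)
        then have "As w = \<theta>s j *s w" by (simp add: eigenspace_def)
        then show "As w \<in> ?S" using base[OF j(2,1)] by (simp add: span_scale)
      qed
    qed
  qed (rule subspace_span)
  moreover obtain w where w: "w \<noteq> 0" "w \<in> Vs 0"
    using eigenvalues(2)[of 0] by (auto simp: is_eigenvalue_def eigenspace_def)
  moreover obtain u where u: "u \<noteq> 0" "u \<in> Vs (Suc i)"
    using eigenvalues(2)[OF i] by (auto simp: is_eigenvalue_def eigenspace_def)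
  ultimately show False
    using base[of w 0] decomposition_disjoint[OF dual_decomposition i, of u] by auto
qed

text \<open>The two neighbours of a dual eigenvalue are distinct roots of one quadratic polynomial; this is the
  formula for the sum of the roots.\<close>

lemma dual_eigenvalue_recurrence:
  assumes rel: "dolan_grady q As A" and q: "q \<noteq> 0" and i: "Suc (Suc i) \<le> d"
  shows "\<theta>s (Suc (Suc i)) = (q^2 + (inverse q)^2) * \<theta>s (Suc i) - \<theta>s i"
proof -
  define p x y z where "p = inverse q" "x = \<theta>s i" "y = \<theta>s (Suc i)" "z = \<theta>s (Suc (Suc i))"
  have qp: "q * p = 1" using q by (simp add: p_x_y_z_def)
  have "(p * y - q * x) * (q * y - p * x) + (q\<^sup>2 - p\<^sup>2)\<^sup>2 = 0"
    "(p * z - q * y) * (q * z - p * y) + (q\<^sup>2 - p\<^sup>2)\<^sup>2 = 0"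
    using dual_eigenvalues_adjacent[OF rel, of i] dual_eigenvalues_adjacent[OF rel, of "Suc i"] i
    by (simp_all only: p_x_y_z_def Suc_leD)
  then have "(z - x) * (z + x - (q\<^sup>2 + p\<^sup>2) * y) = 0"
    using qp by Groebner_Basis.algebra
  moreover have "z \<noteq> x"
    using inj_onD[OF inj(2), of "Suc (Suc i)" i] i by (auto simp: p_x_y_z_def)
  ultimately have "z + x - (q\<^sup>2 + p\<^sup>2) * y = 0" by simp
  then show ?thesis by (simp add: p_x_y_z_def algebra_simps)
qed

end

section \<open>Modules for the q-Onsager algebra\<close>

lemma ring_free_ring: "ring (free_ring :: 'f::field free_alg ring)"
proof (rule ringI)
  show "abelian_group (free_ring :: 'f free_alg ring)"
    by (rule abelian_groupI) (auto simp: free_ring_def add_ac intro: exI[of _ "- _"] left_minus)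
  show "monoid (free_ring :: 'f free_alg ring)"
    by (rule monoidI) (auto simp: free_ring_def mult.assoc)
qed (auto simp: free_ring_def algebra_simps)

lemma ideal_oq_ideal: "ideal (oq_ideal q) free_ring"
  unfolding oq_ideal_def by (rule ring.genideal_ideal[OF ring_free_ring]) (simp add: free_ring_def)

lemma oq_class_hom:
  "oq_class q x \<in> carrier (q_Onsager q)"
  "oq_class q (x * y) = oq_class q x \<otimes>\<^bsub>q_Onsager q\<^esub> oq_class q y"
  "oq_class q (x + y) = oq_class q x \<oplus>\<^bsub>q_Onsager q\<^esub> oq_class q y"
proof -
  have h: "(\<lambda>x. oq_class q x) \<in> ring_hom free_ring (q_Onsager q)"
    unfolding oq_class_def q_Onsager_def by (rule ideal.rcos_ring_hom[OF ideal_oq_ideal])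
  have c: "z \<in> carrier free_ring" for z :: "'a free_alg" by (simp add: free_ring_def)
  show "oq_class q x \<in> carrier (q_Onsager q)"
    by (rule ring_hom_closed[OF h c])
  show "oq_class q (x * y) = oq_class q x \<otimes>\<^bsub>q_Onsager q\<^esub> oq_class q y"
    using ring_hom_mult[OF h c c, of x y] by (simp add: free_ring_def)
  show "oq_class q (x + y) = oq_class q x \<oplus>\<^bsub>q_Onsager q\<^esub> oq_class q y"
    using ring_hom_add[OF h c c, of x y] by (simp add: free_ring_def)
qed

lemma carrier_q_Onsager: "carrier (q_Onsager q) = range (oq_class q)"
  by (auto simp: q_Onsager_def FactRing_def A_RCOSETS_def' oq_class_def free_ring_def)

lemma oq_class_ideal:
  assumes "x \<in> oq_ideal q"
  shows "oq_class q x = oq_class q 0"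
proof -
  interpret ideal "oq_ideal q" free_ring by (rule ideal_oq_ideal)
  have "oq_ideal q +>\<^bsub>free_ring\<^esub> y = oq_ideal q" if "y \<in> oq_ideal q" for y
    using that by (intro a_coset_join2 is_additive_subgroup additive_subgroup.a_subgroup) (simp_all add: free_ring_def)
  moreover have "0 \<in> oq_ideal q"
    using additive_subgroup.zero_closed[OF is_additive_subgroup] by (simp add: free_ring_def)
  ultimately show ?thesis using assms by (simp add: oq_class_def)
qed

lemma relators_in_ideal:
  "oq_relator q (fgen Gen_A) (fgen Gen_As) \<in> oq_ideal q"
  "oq_relator q (fgen Gen_As) (fgen Gen_A) \<in> oq_ideal q"
  unfolding oq_ideal_def
  using ring.genideal_self[OF ring_free_ring, of "{oq_relator q (fgen Gen_A) (fgen Gen_As), oq_relator q (fgen Gen_As) (fgen Gen_A)}"]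
  by (simp_all add: free_ring_def)

text \<open>The free algebra is generated by the constants and the two generators; this is what reduces
  invariance under the whole algebra to invariance under \<open>A\<close> and \<open>A\<^sup>*\<close>.\<close>

lemma free_alg_induct [case_names const gen add mult]:
  assumes const: "\<And>c. P (fconst c)"
    and gen: "\<And>g. P (fgen g)"
    and add: "\<And>x y. P x \<Longrightarrow> P y \<Longrightarrow> P (x + y)"
    and mult: "\<And>x y. P x \<Longrightarrow> P y \<Longrightarrow> P (x * y)"
  shows "P (x :: 'f::field free_alg)"
proof -
  have word: "P (Poly_Mapping.single (Word gs) c)" for gs and c :: 'f
  proof (induction gs)
    case Nil
    then show ?case using const[of c] by (simp add: fconst_def zero_oq_word_def)
  next
    case (Cons g gs)
    have "Poly_Mapping.single (Word (g # gs)) c = fgen g * Poly_Mapping.single (Word gs) c"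
      by (simp add: fgen_def mult_single)
    then show ?case using mult[OF gen Cons] by simp
  qed
  show ?thesis
  proof (induction x rule: update_induct)
    case const
    then show ?case using assms(1)[of 0] by (simp add: fconst_def)
  next
    case (update f w c)
    have "Poly_Mapping.update w c f = Poly_Mapping.single w c + f"
      using update(1) by (intro poly_mapping_eqI) (auto simp: lookup_update lookup_add lookup_single when_def in_keys_iff)
    then show ?case using add[OF word update(3)] by (cases w) simp
  qed
qed

lemma q_Onsager_action:
  assumes "oq_module q scale act"
  defines "\<rho> \<equiv> \<lambda>x. act (oq_class q x)"
  shows "Vector_Spaces.linear scale scale (\<rho> x)" "\<rho> (x + y) v = \<rho> x v + \<rho> y v" "\<rho> (x * y) v = \<rho> x (\<rho> y v)"
    "\<rho> (fconst c) v = scale c v" "\<rho> (x - y) v = \<rho> x v - \<rho> y v"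
proof -
  note module = assms(1)[unfolded oq_module_def]
  show "Vector_Spaces.linear scale scale (\<rho> x)"
    unfolding \<rho>_def using module oq_class_hom(1)[of q x] by blast
  show add: "\<rho> (x + y) v = \<rho> x v + \<rho> y v" for x y
    unfolding \<rho>_def oq_class_hom(3) using module oq_class_hom(1)[of q x] oq_class_hom(1)[of q y] by blast
  show "\<rho> (x * y) v = \<rho> x (\<rho> y v)"
    unfolding \<rho>_def oq_class_hom(2) using module oq_class_hom(1)[of q x] oq_class_hom(1)[of q y] by blast
  show "\<rho> (fconst c) v = scale c v"
    unfolding \<rho>_def using module by blast
  show "\<rho> (x - y) v = \<rho> x v - \<rho> y v"
    using add[of "x - y" y] by (simp add: algebra_simps)
qed

lemma (in scalar_space) q_Onsager_dolan_grady:
  assumes mod: "oq_module q scale act"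
  shows "dolan_grady q (act (oq_A q)) (act (oq_As q))" "dolan_grady q (act (oq_As q)) (act (oq_A q))"
proof -
  note \<rho> = q_Onsager_action[OF mod]
  have zero: "act (oq_class q x) v = 0" if "x \<in> oq_ideal q" for x v
    using \<rho>(4)[of 0 v] oq_class_ideal[OF that] by (simp add: fconst_def)
  have rel: "dolan_grady q (act (oq_class q x)) (act (oq_class q y))" if "oq_relator q x y \<in> oq_ideal q" for x y
    unfolding dolan_grady_def Let_def
  proof
    fix v
    show "act (oq_class q x) (inverse q *s act (oq_class q x) (q *s act (oq_class q x) (act (oq_class q y) v)
          - inverse q *s act (oq_class q y) (act (oq_class q x) v))
        - q *s (q *s act (oq_class q x) (act (oq_class q y) (act (oq_class q x) v))
          - inverse q *s act (oq_class q y) (act (oq_class q x) (act (oq_class q x) v))))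
      - (inverse q *s act (oq_class q x) (q *s act (oq_class q x) (act (oq_class q y) (act (oq_class q x) v))
          - inverse q *s act (oq_class q y) (act (oq_class q x) (act (oq_class q x) v)))
        - q *s (q *s act (oq_class q x) (act (oq_class q y) (act (oq_class q x) (act (oq_class q x) v)))
          - inverse q *s act (oq_class q y) (act (oq_class q x) (act (oq_class q x) (act (oq_class q x) v)))))
      = ((q^2 - (inverse q)^2)^2) *s (act (oq_class q y) (act (oq_class q x) v) - act (oq_class q x) (act (oq_class q y) v))"
      using zero[OF that, of v]
      by (simp only: oq_relator_def comm_def qcomm_def \<rho>(3-5) inverse_inverse_eq right_minus_eq)
  qed
  show "dolan_grady q (act (oq_A q)) (act (oq_As q))" "dolan_grady q (act (oq_As q)) (act (oq_A q))"
    unfolding oq_A_def oq_As_def by (rule rel, rule relators_in_ideal)+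
qed

lemma (in scalar_space) q_Onsager_irreducible:
  assumes irr: "irreducible_oq_module q scale act"
    and W: "subspace W" "act (oq_A q) ` W \<subseteq> W" "act (oq_As q) ` W \<subseteq> W"
  shows "W = {0} \<or> W = UNIV"
proof -
  have mod: "oq_module q scale act"
    using irr by (simp add: irreducible_oq_module_def)
  note \<rho> = q_Onsager_action[OF mod]
  have "\<forall>w\<in>W. act (oq_class q x) w \<in> W" for x
  proof (induction x rule: free_alg_induct)
    case (gen g)
    then show ?case using W by (cases g) (auto simp: oq_A_def oq_As_def)
  qed (use W(1) in \<open>auto simp: \<rho> subspace_scale subspace_add\<close>)
  then have "\<forall>x\<in>carrier (q_Onsager q). act x ` W \<subseteq> W"
    by (auto simp: carrier_q_Onsager)
  then show ?thesis
    using irr W(1) by (simp add: irreducible_oq_module_def)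
qed

section \<open>The equitable triples of a tridiagonal pair\<close>

lemma inj_on_reverse: "inj_on f {..d::nat} \<Longrightarrow> inj_on (\<lambda>i. f (d - i)) {..d}"
  by (rule inj_onI) (metis atMost_iff diff_diff_cancel diff_le_self inj_onD)

lemma subspace_sum_reverse:
  assumes "i \<le> d"
  shows "subspace_sum scale {i..d} (\<lambda>j. W (d - j)) = subspace_sum scale {0..d - i} W"
    and "subspace_sum scale {0..i} (\<lambda>j. W (d - j)) = subspace_sum scale {d - i..d} W"
proof -
  have "(\<lambda>j. d - j) ` {i..d} = {0..d - i}"
  proof (intro equalityI subsetI)
    fix k assume "k \<in> {0..d - i}"
    then show "k \<in> (\<lambda>j. d - j) ` {i..d}" using assms by (intro image_eqI[of _ _ "d - k"]) auto
  qed auto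
  then show "subspace_sum scale {i..d} (\<lambda>j. W (d - j)) = subspace_sum scale {0..d - i} W"
    unfolding subspace_sum_def by (metis image_image)
  have "(\<lambda>j. d - j) ` {0..i} = {d - i..d}"
  proof (intro equalityI subsetI)
    fix k assume "k \<in> {d - i..d}"
    then show "k \<in> (\<lambda>j. d - j) ` {0..i}" using assms by (intro image_eqI[of _ _ "d - k"]) auto
  qed (use assms in auto)
  then show "subspace_sum scale {0..i} (\<lambda>j. W (d - j)) = subspace_sum scale {d - i..d} W"
    unfolding subspace_sum_def by (metis image_image)
qed

lemma corresponding_map_cong:
  "(\<And>i. i \<le> d \<Longrightarrow> W i = W' i) \<Longrightarrow> corresponding_map scale q d W = corresponding_map scale q d W'"
  unfolding corresponding_map_def by simp

context tridiagonal_pair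
begin

lemma reverse_pair: "tridiagonal_pair scale A As d (\<lambda>i. \<theta> (d - i)) \<theta>s"
proof (rule tridiagonal_pair.intro[OF scalar_space_axioms], rule tridiagonal_pair_axioms.intro)
  show "inj_on (\<lambda>i. \<theta> (d - i)) {..d}" by (rule inj_on_reverse[OF inj(1)])
  show "span (\<Union>i\<in>{..d}. V (d - i)) = UNIV"
    unfolding UN_reverse[where W = V] by (rule spans(1))
  show "acts_tridiagonally scale d As (\<lambda>i. V (d - i))" by (rule acts_tridiagonally_reverse[OF tridiagonal(1)])
  show "is_eigenvalue scale A (\<theta> (d - i))" for i by (rule eigenvalues(1)) simp
qed (rule lin_A lin_As inj(2) spans(2) eigenvalues(2) tridiagonal(2) irreducible; assumption)+

lemma reverse_dual_pair: "tridiagonal_pair scale A As d \<theta> (\<lambda>i. \<theta>s (d - i))"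
proof (rule tridiagonal_pair.intro[OF scalar_space_axioms], rule tridiagonal_pair_axioms.intro)
  show "inj_on (\<lambda>i. \<theta>s (d - i)) {..d}" by (rule inj_on_reverse[OF inj(2)])
  show "span (\<Union>i\<in>{..d}. Vs (d - i)) = UNIV"
    unfolding UN_reverse[where W = Vs] by (rule spans(2))
  show "acts_tridiagonally scale d A (\<lambda>i. Vs (d - i))" by (rule acts_tridiagonally_reverse[OF tridiagonal(2)])
  show "is_eigenvalue scale As (\<theta>s (d - i))" for i by (rule eigenvalues(2)) simp
qed (rule lin_A lin_As inj(1) spans(1) eigenvalues(1) tridiagonal(1) irreducible; assumption)+

text \<open>The triple for \<open>B\<close> is the triple for \<open>K\<close> after reversing the eigenspaces of
  \<open>A\<close>, which replaces \<open>a\<close> by its inverse: the map \<open>N\<close> is unchanged, and the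
  quadratic expression is multiplied by a nonzero scalar.\<close>

lemma split_equitable_triples:
  assumes q: "q \<noteq> 0" "q \<noteq> inverse q" and a: "a \<noteq> 0" "a\<^sup>2 \<noteq> 1"
    and theta: "\<And>i. i \<le> d \<Longrightarrow> \<theta> i = a * q powi (int d - 2 * int i) + inverse a * q powi (2 * int i - int d)"
    and thetas: "\<And>i. i \<le> d \<Longrightarrow> \<theta>s i = b * q powi (int d - 2 * int i) + c * q powi (2 * int i - int d)"
    and K: "K = corresponding_map scale q d (\<lambda>i. subspace_sum scale {0..i} Vs \<inter> subspace_sum scale {i..d} V)"
    and B: "B = corresponding_map scale q d (\<lambda>i. subspace_sum scale {0..i} Vs \<inter> subspace_sum scale {0..d - i} V)"
    and N: "N = lin_comb2 scale (inverse a / (inverse a - a)) (map_inv K) (- a / (inverse a - a)) (map_inv B)"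
  shows "equitable_triple scale q (map_inv B) (map_inv N) (lin_comb2 scale a A (- (a^2)) (map_inv B))"
    and "equitable_triple scale q (map_inv K) (map_inv N) (lin_comb2 scale (inverse a) A (- (inverse a ^ 2)) (map_inv K))"
proof -
  interpret R: tridiagonal_pair scale A As d "\<lambda>i. \<theta> (d - i)" \<theta>s by (rule reverse_pair)
  define X Y where "X = map_inv K" and "Y = map_inv B"
  have "B = corresponding_map scale q d (\<lambda>i. subspace_sum scale {0..i} Vs \<inter> subspace_sum scale {i..d} R.V)"
    unfolding B by (rule corresponding_map_cong) (simp only: subspace_sum_reverse(1)[where W = V])
  from R.corresponding_map_split[OF q(1) this] have Y: "R.split_map q Y" "bij Y" by (simp_all add: Y_def)
  from corresponding_map_split[OF q(1) K] have X: "split_map q X" "bij X" by (simp_all add: X_def)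
  have linX: "lin X" and linY: "lin Y"
    using lin_split_map[OF X(1)] R.lin_split_map[OF Y(1)] .
  have rtheta: "\<theta> (d - i) = inverse a * q powi (int d - 2 * int i) + inverse (inverse a) * q powi (2 * int i - int d)"
    if "i \<le> d" for i
    using theta[of "d - i"] that by (simp add: of_nat_diff algebra_simps)
  have a': "inverse a \<noteq> 0" "(inverse a)\<^sup>2 \<noteq> 1" using a by (simp_all add: power_inverse)
  have XA: "q *s A (X v) - inverse q *s X (A v) = (q - inverse q) *s (a *s v + inverse a *s X (X v))" for v
    by (rule split_map_A_relation[OF X(1) q(1) a(1)]) (rule theta)
  have YA': "q *s A (Y v) - inverse q *s Y (A v) = (q - inverse q) *s (inverse a *s v + inverse (inverse a) *s Y (Y v))" for v
    by (rule R.split_map_A_relation[OF Y(1) q(1) a'(1)]) (rule rtheta)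
  note YA = YA'[unfolded inverse_inverse_eq]
  have XAs: "q *s X (As v) - inverse q *s As (X v) = (q - inverse q) *s (b *s v + c *s X (X v))" for v
    by (rule split_map_As_relation[OF X(1) q(1)]) (rule thetas)
  have YAs: "q *s Y (As v) - inverse q *s As (Y v) = (q - inverse q) *s (b *s v + c *s Y (Y v))" for v
    by (rule R.split_map_As_relation[OF Y(1) q(1)]) (rule thetas)
  have XA': "q *s A (X v) - inverse q *s X (A v) = (q - inverse q) *s (inverse (inverse a) *s v + inverse a *s X (X v))" for v
    using XA by simp
  have N: "N = lin_comb2 scale (inverse a / (inverse a - a)) X (- a / (inverse a - a)) Y"
    by (simp add: N X_def Y_def)
  have Q: "quadratic (q - inverse q) (a\<^sup>2 * (q - inverse q)) (a\<^sup>2 * q - inverse q) (q - a\<^sup>2 * inverse q) X Y v = 0" for v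
  proof (rule split_maps_quadratic_relation[OF lin_A lin_As linX linY _ q(1) a XA YA XAs YAs subspace_flags(1)[of "Suc 0"]])
    show "W = {0} \<or> W = UNIV" if "subspace W" "A ` W \<subseteq> W" "As ` W \<subseteq> W" for W
      using that by (rule irreducible)
    obtain w where w: "w \<noteq> 0" "w \<in> Vs 0"
      using eigenvalues(2)[of 0] by (auto simp: is_eigenvalue_def eigenspace_def)
    have "w \<in> F (Suc 0)"
      unfolding F_def using w by (intro span_base) auto
    then show "F (Suc 0) \<noteq> {0}" using w by blast
    fix u assume u: "u \<in> F (Suc 0)"
    show "X u = q powi (- int d) *s u"
      using split_map_triangular[OF X(1) _ u] by (simp add: F_0)
    show "Y u = q powi (- int d) *s u"
      using R.split_map_triangular[OF Y(1) _ u] by (simp add: F_0)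
  qed
  \<comment> \<open>The coefficients of \<open>N\<close> sum to one, and \<open>X\<close> and \<open>Y\<close> are triangular on the
    same flag with the same diagonal; so \<open>N\<close> is triangular with that diagonal too.\<close>
  have bijN: "bij N"
  proof (rule triangular_on_F_bij)
    show "lin N" unfolding N lin_comb2_def by (rule lin_combine[OF linX linY])
    fix i assume i: "i \<le> d"
    show "q powi (2 * int i - int d) \<noteq> 0" using q by (simp add: power_int_not_zero)
    fix v assume v: "v \<in> F (Suc i)"
    define k where "k = q powi (2 * int i - int d)"
    have "inverse a - a \<noteq> 0" using a by (simp add: field_simps power2_eq_square)
    then have "inverse a / (inverse a - a) + - a / (inverse a - a) = 1" by (simp flip: diff_divide_distrib)
    then have "k *s v = (inverse a / (inverse a - a)) *s (k *s v) + (- a / (inverse a - a)) *s (k *s v)"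
      by (simp only: scale_left_distrib[symmetric] scale_one)
    then have "N v - k *s v = (inverse a / (inverse a - a)) *s (X v - k *s v) + (- a / (inverse a - a)) *s (Y v - k *s v)"
      unfolding N lin_comb2_def by (simp only: scale_right_diff_distrib) (simp only: algebra_simps)
    then show "N v - q powi (2 * int i - int d) *s v \<in> F i"
      unfolding k_def using split_map_triangular[OF X(1) i v] R.split_map_triangular[OF Y(1) i v]
      by (simp only: subspace_add subspace_scale subspace_flags)
  qed
  have bijK: "bij (lin_comb2 scale (inverse a) A (- (inverse a ^ 2)) X)"
    by (rule split_shift_bij[OF X(1) q(1) a(1)]) (rule theta)
  have bijB: "bij (lin_comb2 scale a A (- (a ^ 2)) Y)"
    using R.split_shift_bij[OF Y(1) q(1) a'(1), OF rtheta] by simp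
  show "equitable_triple scale q (map_inv K) (map_inv N) (lin_comb2 scale (inverse a) A (- (inverse a ^ 2)) (map_inv K))"
    using equitable_triple_of_quadratic_relation[OF lin_A linX linY q a XA YA Q N refl X(2) bijN bijK]
    by (simp only: X_def)
  have N': "N = lin_comb2 scale (inverse (inverse a) / (inverse (inverse a) - inverse a)) Y (- inverse a / (inverse (inverse a) - inverse a)) X"
  proof -
    have "a / (a - inverse a) = - a / (inverse a - a)" "- inverse a / (a - inverse a) = inverse a / (inverse a - a)"
      using minus_divide_divide[of a "inverse a - a"] minus_divide_divide[of "inverse a" "inverse a - a"] 
      by (metis minus_diff_eq minus_divide_right minus_divide_left)+
    then show ?thesis
      unfolding N lin_comb2_def inverse_inverse_eq by (simp only: add.commute)
  qed
  have Q': "quadratic (q - inverse q) ((inverse a)\<^sup>2 * (q - inverse q)) ((inverse a)\<^sup>2 * q - inverse q) (q - (inverse a)\<^sup>2 * inverse q) Y X v = 0" for v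
  proof -
    have "(inverse a)\<^sup>2 * a\<^sup>2 = 1" using a(1) by (simp add: power_inverse)
    then have "quadratic (q - inverse q) ((inverse a)\<^sup>2 * (q - inverse q)) ((inverse a)\<^sup>2 * q - inverse q) (q - (inverse a)\<^sup>2 * inverse q) Y X v
      = (inverse a)\<^sup>2 *s quadratic (q - inverse q) (a\<^sup>2 * (q - inverse q)) (a\<^sup>2 * q - inverse q) (q - a\<^sup>2 * inverse q) X Y v"
      unfolding quadratic_def
      by (simp add: scale_right_distrib scale_right_diff_distrib right_diff_distrib mult.assoc[symmetric] del: power_inverse)
    then show ?thesis by (simp add: Q)
  qed
  show "equitable_triple scale q (map_inv B) (map_inv N) (lin_comb2 scale a A (- (a^2)) (map_inv B))"
    using equitable_triple_of_quadratic_relation[OF lin_A linY linX q a' YA' XA' Q' N' refl Y(2) bijN] bijB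
    by (simp add: Y_def)
qed

end

theorem theorem8p2:
  fixes scale :: "'f::field \<Rightarrow> 'v::ab_group_add \<Rightarrow> 'v"
    and Basis :: "'v set"
    and act :: "'f free_alg set \<Rightarrow> 'v \<Rightarrow> 'v"
    and q a :: 'f and d :: nat
    and \<theta> \<theta>s :: "nat \<Rightarrow> 'f"
    and V Vs :: "nat \<Rightarrow> 'v set"
    and A As K B Kd Bd N Nd :: "'v \<Rightarrow> 'v"
  assumes q_nonzero: "q \<noteq> 0"
    and q_not_root_of_unity: "\<And>n::nat. n > 0 \<Longrightarrow> q ^ n \<noteq> 1"
    and findim: "finite_dimensional_vector_space scale Basis"
    and dim: "vector_space.dim scale (UNIV :: 'v set) \<ge> 2"
    and irred: "irreducible_oq_module q scale act"
    and A: "A = act (oq_A q)"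
    and As: "As = act (oq_As q)"
    and diag_A: "diagonalizable scale A"
    and diag_As: "diagonalizable scale As"
    and d: "d \<ge> 1"
    and a_nonzero: "a \<noteq> 0"
    and theta: "\<And>i. i \<le> d \<Longrightarrow>
          \<theta> i = a * q powi (int d - 2 * int i) + inverse a * q powi (2 * int i - int d)"
    and ord_A: "eigenvalue_ordering scale A d \<theta>"
    and V: "V = (\<lambda>i. eigenspace scale A (\<theta> i))"
    and ord_As: "eigenvalue_ordering scale As d \<theta>s"
    and Vs: "Vs = (\<lambda>i. eigenspace scale As (\<theta>s i))"
    and tridiag: "acts_tridiagonally scale d A Vs"
    and K: "K = corresponding_map scale q d
          (\<lambda>i. subspace_sum scale {0..i} Vs \<inter> subspace_sum scale {i..d} V)"
    and B: "B = corresponding_map scale q d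
          (\<lambda>i. subspace_sum scale {0..i} Vs \<inter> subspace_sum scale {0..d - i} V)"
    and Kd: "Kd = corresponding_map scale q d
          (\<lambda>i. subspace_sum scale {d - i..d} Vs \<inter> subspace_sum scale {i..d} V)"
    and Bd: "Bd = corresponding_map scale q d
          (\<lambda>i. subspace_sum scale {d - i..d} Vs \<inter> subspace_sum scale {0..d - i} V)"
    and N: "N = lin_comb2 scale (inverse a / (inverse a - a)) (map_inv K)
                                (- a / (inverse a - a)) (map_inv B)"
    and Nd: "Nd = lin_comb2 scale (inverse a / (inverse a - a)) (map_inv Kd)
                                  (- a / (inverse a - a)) (map_inv Bd)"
  shows "(\<forall>x y z X Y Z.
            (x, X, y) \<in> labelled_arcs scale a A K B Kd Bd N Nd \<and>
            (y, Y, z) \<in> labelled_arcs scale a A K B Kd Bd N Nd \<and>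
            (z, Z, x) \<in> labelled_arcs scale a A K B Kd Bd N Nd
            \<longrightarrow> equitable_triple scale q X Y Z)
       \<and> equitable_triple scale q (map_inv B) (map_inv N)
            (lin_comb2 scale a A (- (a^2)) (map_inv B))
       \<and> equitable_triple scale q (map_inv K) (map_inv N)
            (lin_comb2 scale (inverse a) A (- (inverse a ^ 2)) (map_inv K))
       \<and> equitable_triple scale q (map_inv Bd) (map_inv Nd)
            (lin_comb2 scale a A (- (a^2)) (map_inv Bd))
       \<and> equitable_triple scale q (map_inv Kd) (map_inv Nd)
            (lin_comb2 scale (inverse a) A (- (inverse a ^ 2)) (map_inv Kd))"
proof -
  interpret scalar_space scale
    using findim by (simp add: scalar_space_def finite_dimensional_vector_space_def)
  have module: "oq_module q scale act"
    using irred by (simp add: irreducible_oq_module_def)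
  have lin: "lin A" "lin As"
    using q_Onsager_action(1)[OF module] by (simp_all add: A As oq_A_def oq_As_def)
  have rel: "dolan_grady q A As" "dolan_grady q As A"
    using q_Onsager_dolan_grady[OF module] by (simp_all add: A As)
  note decV = eigenspace_decomposition[OF lin(1) diag_A ord_A] and decVs = eigenspace_decomposition[OF lin(2) diag_As ord_As]
  have inj: "inj_on \<theta> {..d}" "inj_on \<theta>s {..d}"
    using ord_A ord_As by (simp_all add: eigenvalue_ordering_def atMost_atLeast0)
  have theta': "\<theta> i = askey_wilson q a d (int i)" if "i \<le> d" for i
    using theta[OF that] by (simp add: askey_wilson_def)
  have inj': "i = j" if "i \<le> d" "j \<le> d" "askey_wilson q a d (int i) = askey_wilson q a d (int j)" for i j
    using that inj_onD[OF inj(1), of i j] theta' by simp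
  have pair: "tridiagonal_pair scale A As d \<theta> \<theta>s"
  proof (rule tridiagonal_pair.intro[OF scalar_space_axioms], rule tridiagonal_pair_axioms.intro)
    show "acts_tridiagonally scale d As (\<lambda>i. eigenspace scale A (\<theta> i))"
    proof (rule dolan_grady_tridiagonal[OF lin rel(1) decV])
      fix i j assume ij: "i \<le> d" "j \<le> d" and "\<theta> j = \<theta> i \<or>
        (inverse q * \<theta> j - q * \<theta> i) * (q * \<theta> j - inverse q * \<theta> i) + (q\<^sup>2 - (inverse q)\<^sup>2)\<^sup>2 = 0"
      then show "i \<le> j + 1 \<and> j \<le> i + 1"
      proof (elim disjE)
        assume "\<theta> j = \<theta> i"
        then show ?thesis using inj_onD[OF inj(1), of j i] ij by simp
      next
        assume "(inverse q * \<theta> j - q * \<theta> i) * (q * \<theta> j - inverse q * \<theta> i) + (q\<^sup>2 - (inverse q)\<^sup>2)\<^sup>2 = 0"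
        then show ?thesis
          unfolding theta'[OF ij(1)] theta'[OF ij(2)]
          using askey_wilson_adjacent[of q a d i j] q_nonzero q_not_root_of_unity a_nonzero inj' ij by blast
      qed
    qed
    show "W = {0} \<or> W = UNIV" if "subspace W" "A ` W \<subseteq> W" "As ` W \<subseteq> W" for W
      using q_Onsager_irreducible[OF irred] that by (simp only: A As)
    show "is_eigenvalue scale A (\<theta> i)" "is_eigenvalue scale As (\<theta>s i)" if "i \<le> d" for i
      using ord_A ord_As that unfolding eigenvalue_ordering_def by auto
  qed (use lin inj tridiag decomposition_spans[OF decV] decomposition_spans[OF decVs] in \<open>simp_all add: Vs\<close>)
  then interpret P: tridiagonal_pair scale A As d \<theta> \<theta>s .
  have q4: "q ^ 4 \<noteq> 1" and q2: "q \<noteq> inverse q"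
    using q_not_root_of_unity[of 4] q_not_root_of_unity[of 2] q_nonzero
    by (auto simp: power2_eq_square) (metis right_inverse)
  have a2: "a\<^sup>2 \<noteq> 1"
  proof
    assume "a\<^sup>2 = 1"
    then have "inverse a = a" using a_nonzero by (simp add: power2_eq_square field_simps)
    then have "\<theta> 0 = \<theta> d" using theta[of 0] theta[of d] by simp
    then show False using inj_onD[OF inj(1), of 0 d] d by simp
  qed
  obtain b c where thetas: "\<And>i. i \<le> d \<Longrightarrow> \<theta>s i = b * q powi (int d - 2 * int i) + c * q powi (2 * int i - int d)"
  proof (rule three_term_recurrence_solution[OF q_nonzero q4, where s = \<theta>s and d = d])
    show "\<theta>s (Suc (Suc i)) = (q\<^sup>2 + (inverse q)\<^sup>2) * \<theta>s (Suc i) - \<theta>s i" if "Suc (Suc i) \<le> d" for i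
      by (rule P.dual_eigenvalue_recurrence[OF rel(2) q_nonzero that])
  qed (rule that)
  have rthetas: "\<theta>s (d - i) = c * q powi (int d - 2 * int i) + b * q powi (2 * int i - int d)" if "i \<le> d" for i
    using thetas[of "d - i"] that by (simp add: of_nat_diff algebra_simps)
  have triples: "equitable_triple scale q (map_inv B) (map_inv N) (lin_comb2 scale a A (- (a^2)) (map_inv B))"
    "equitable_triple scale q (map_inv K) (map_inv N) (lin_comb2 scale (inverse a) A (- (inverse a ^ 2)) (map_inv K))"
    by (rule P.split_equitable_triples[OF q_nonzero q2 a_nonzero a2 _ _ K[unfolded V Vs] B[unfolded V Vs] N];
        rule theta thetas; assumption)+
  \<comment> \<open>Reversing the dual ordering exchanges \<open>b\<close> and \<open>c\<close> and turns \<open>K\<close> and \<open>B\<close>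
    into \<open>Kd\<close> and \<open>Bd\<close>.\<close>
  interpret R: tridiagonal_pair scale A As d \<theta> "\<lambda>i. \<theta>s (d - i)" by (rule P.reverse_dual_pair)
  have Kd': "Kd = corresponding_map scale q d (\<lambda>i. subspace_sum scale {0..i} R.Vs \<inter> subspace_sum scale {i..d} R.V)"
    unfolding Kd V Vs by (rule corresponding_map_cong) (simp only: subspace_sum_reverse(2)[where W = P.Vs])
  have Bd': "Bd = corresponding_map scale q d (\<lambda>i. subspace_sum scale {0..i} R.Vs \<inter> subspace_sum scale {0..d - i} R.V)"
    unfolding Bd V Vs by (rule corresponding_map_cong) (simp only: subspace_sum_reverse(2)[where W = P.Vs])
  have triplesd: "equitable_triple scale q (map_inv Bd) (map_inv Nd) (lin_comb2 scale a A (- (a^2)) (map_inv Bd))"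
    "equitable_triple scale q (map_inv Kd) (map_inv Nd) (lin_comb2 scale (inverse a) A (- (inverse a ^ 2)) (map_inv Kd))"
    by (rule R.split_equitable_triples[OF q_nonzero q2 a_nonzero a2 _ _ Kd' Bd' Nd];
        rule theta rthetas; assumption)+
  note all = triples triplesd
  note rotations = all all[THEN equitable_triple_rotate] all[THEN equitable_triple_rotate, THEN equitable_triple_rotate]
  show ?thesis
  proof (intro conjI allI impI)
    fix x y z X Y Z
    assume "(x, X, y) \<in> labelled_arcs scale a A K B Kd Bd N Nd \<and>
      (y, Y, z) \<in> labelled_arcs scale a A K B Kd Bd N Nd \<and>
      (z, Z, x) \<in> labelled_arcs scale a A K B Kd Bd N Nd"
    then show "equitable_triple scale q X Y Z"
      \<comment> \<open>Composable triples of arcs are the four cycles, each with three starting points.\<close>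
      unfolding labelled_arcs_def by (elim conjE insertE emptyE; simp add: rotations)
  qed (rule all)+
qed

end
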